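(* Let $n$ and $i$ be integers with $1 \leq i \leq \lfloor \frac{n}{2} \rfloor$, let $S = \{1,2,\ldots,\lfloor \frac{n}{2} \rfloor\}\setminus\{i\}$, and let $G = C_n(S)$. Then $G$ is Buchsbaum. Furthermore, for each of the three properties "vertex decomposable", "shellable", "Cohen-Macaulay", the graph $G$ has that property if and only if $\gcd(i,n)=1$.
   Context: For an integer $n\ge 1$ and a set $S\subseteq\{1,\ldots,\lfloor n/2\rfloor\}$, the circulant graph $C_n(S)$ has vertex set $\{0,1,\ldots,n-1\}$, and distinct $a,b$ are adjacent if and only if $|a-b|\in S$ or $n-|a-b|\in S$. The independence complex $\mathrm{Ind}(G)$ of a finite simple graph $G$ is the simplicial complex of all independent sets of $G$. A simplicial complex is pure if all its facets have the same dimension. For a simplicial complex $\Delta$ and a face $F$: $\mathrm{link}_\Delta(F)=\{H\in\Delta : F\cap H=\emptyset,\ F\cup H\in\Delta\}$ and $\mathrm{del}_\Delta(F)=\{H\in\Delta : F\not\subseteq H\}$; for a vertex $x$ write $x$ instead of $\{x\}$. Also $\dim F=|F|-1$. Fix a field $k$. A pure simplicial complex $\Delta$ is: - vertex decomposable if $\Delta$ is a simplex (its whole vertex set is its unique facet), or there is a vertex $x$ such that $\mathrm{link}_\Delta(x)$ and $\mathrm{del}_\Delta(x)$ are (pure and) vertex decomposable; - shellable if its facets can be ordered $F_1,\ldots,F_t$ so that for all $1\le j<r\le t$ there are $x\in F_r\setminus F_j$ and $l\in\{1,\ldots,r-1\}$ with $F_r\setminus F_l=\{x\}$; - Cohen-Macaulay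 if for all $F\in\Delta$, $\tilde H_j(\mathrm{link}_\Delta(F),k)=0$ for all $j<\dim \mathrm{link}_\Delta(F)$ (reduced simplicial homology); - Buchsbaum if $\mathrm{link}_\Delta(x)$ is Cohen-Macaulay for every vertex $x$. A graph $G$ is said to have one of these properties if $\mathrm{Ind}(G)$ is pure and has it. *)

theory Defs
  imports "HOL-Algebra.Elementary_Groups" "Graph_Theory.Pair_Digraph"
begin

section \<open>Circulant graphs and independence complexes\<close>

text \<open>
  A finite simple graph is a \<open>pair_graph\<close>: a finite vertex set with a symmetric
  irreflexive set of arcs, each edge being represented by its two orientations.
\<close>

definition circulant :: "nat \<Rightarrow> nat set \<Rightarrow> nat pair_pre_digraph" where
  "circulant n S =
    \<lparr> pverts = {0..<n},
      parcs = {(a, b). a \<in> {0..<n} \<and> b \<in> {0..<n} \<and> a \<noteq> b \<and>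
                (let d = nat \<bar>int a - int b\<bar> in d \<in> S \<or> n - d \<in> S)} \<rparr>"

lemma pair_graph_circulant: "pair_graph (circulant n S)"
proof
  show "finite (parcs (circulant n S))"
    by (rule finite_subset[of _ "{0..<n} \<times> {0..<n}"]) (auto simp: circulant_def)
  show "symmetric (with_proj (circulant n S))"
    by (auto simp: circulant_def symmetric_def sym_def abs_minus_commute)
qed (auto simp: circulant_def)

definition ind_complex :: "'a pair_pre_digraph \<Rightarrow> 'a set set" where
  "ind_complex G = {W. W \<subseteq> pverts G \<and> (\<forall>a\<in>W. \<forall>b\<in>W. (a, b) \<notin> parcs G)}"


section \<open>Simplicial complexes\<close>

text \<open>
  A complex is given by its set of faces, the empty face included.  Its vertices are the
  \<open>x\<close> with \<open>{x} \<in> \<Delta>\<close>, so that its vertex set is \<open>\<Union>\<Delta>\<close>.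
\<close>

definition abstract_complex :: "'a set set \<Rightarrow> bool" where
  "abstract_complex \<Delta> \<longleftrightarrow>
    finite (\<Union>\<Delta>) \<and> {} \<in> \<Delta> \<and> (\<forall>F\<in>\<Delta>. \<forall>H. H \<subseteq> F \<longrightarrow> H \<in> \<Delta>)"

lemma abstract_complex_ind_complex:
  assumes "pair_graph G"
  shows "abstract_complex (ind_complex G)"
proof -
  interpret pair_graph G by fact
  have "\<Union>(ind_complex G) \<subseteq> pverts G"
    by (auto simp: ind_complex_def)
  then have "finite (\<Union>(ind_complex G))"
    using finite_subset pair_finite_verts by blast
  then show ?thesis
    by (auto simp: abstract_complex_def ind_complex_def)
qed

definition facets :: "'a set set \<Rightarrow> 'a set set" where
  "facets \<Delta> = {F \<in> \<Delta>. \<forall>H\<in>\<Delta>. F \<subseteq> H \<longrightarrow> H = F}"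

definition face_dim :: "'a set \<Rightarrow> int" where
  "face_dim F = int (card F) - 1"

definition complex_dim :: "'a set set \<Rightarrow> int" where
  "complex_dim \<Delta> = Max (face_dim ` \<Delta>)"

definition pure_complex :: "'a set set \<Rightarrow> bool" where
  "pure_complex \<Delta> \<longleftrightarrow>
    abstract_complex \<Delta> \<and> (\<forall>F\<in>facets \<Delta>. \<forall>H\<in>facets \<Delta>. face_dim F = face_dim H)"

definition link :: "'a set set \<Rightarrow> 'a set \<Rightarrow> 'a set set" where
  "link \<Delta> F = {H \<in> \<Delta>. F \<inter> H = {} \<and> F \<union> H \<in> \<Delta>}"

definition del :: "'a set set \<Rightarrow> 'a set \<Rightarrow> 'a set set" where
  "del \<Delta> F = {H \<in> \<Delta>. \<not> F \<subseteq> H}"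


section \<open>Reduced simplicial homology over a field\<close>

text \<open>
  The \<open>j\<close>-chains of a finite complex are the functions from sets to the field that vanish
  off the \<open>j\<close>-dimensional faces.  Here \<open>j\<close> is an arbitrary integer and the empty face spans
  the chains of degree \<open>-1\<close>, which is what makes the homology reduced.
\<close>

definition chains :: "'a set set \<Rightarrow> int \<Rightarrow> ('a set \<Rightarrow> 'k::field) set" where
  "chains \<Delta> j = {c. \<forall>F. c F \<noteq> 0 \<longrightarrow> F \<in> \<Delta> \<and> face_dim F = j}"

text \<open>
  Faces are oriented by the order of the vertices: for \<open>v\<^sub>0 < \<dots> < v\<^sub>j\<close> the boundary of
  the face \<open>{v\<^sub>0, \<dots>, v\<^sub>j}\<close> is the sum of \<open>(-1)^i\<close> times the face that omits \<open>v\<^sub>i\<close>, and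
  \<open>i\<close> is the number of vertices of the face below \<open>v\<^sub>i\<close>.
\<close>

definition chain_boundary ::
    "'a::linorder set set \<Rightarrow> ('a set \<Rightarrow> 'k::field) \<Rightarrow> 'a set \<Rightarrow> 'k" where
  "chain_boundary \<Delta> c =
    (\<lambda>H. \<Sum>F\<in>\<Delta>. \<Sum>v\<in>F. if F - {v} = H then (-1) ^ card {u \<in> F. u < v} * c F else 0)"

definition cycles :: "'a::linorder set set \<Rightarrow> int \<Rightarrow> ('a set \<Rightarrow> 'k::field) set" where
  "cycles \<Delta> j = {c \<in> chains \<Delta> j. chain_boundary \<Delta> c = (\<lambda>_. 0)}"

definition boundaries :: "'a::linorder set set \<Rightarrow> int \<Rightarrow> ('a set \<Rightarrow> 'k::field) set" where
  "boundaries \<Delta> j = chain_boundary \<Delta> ` chains \<Delta> (j + 1)"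

definition cycle_group ::
    "'a::linorder set set \<Rightarrow> int \<Rightarrow> ('a set \<Rightarrow> 'k::field) monoid" where
  "cycle_group \<Delta> j =
    \<lparr> carrier = cycles \<Delta> j, monoid.mult = (\<lambda>c d F. c F + d F), one = (\<lambda>_. 0) \<rparr>"

text \<open>
  Only the additive group of the homology vector space is recorded; the space is zero if
  and only if this group is trivial.
\<close>

definition reduced_homology ::
    "'k itself \<Rightarrow> 'a::linorder set set \<Rightarrow> int \<Rightarrow> ('a set \<Rightarrow> 'k::field) set monoid" where
  "reduced_homology _ \<Delta> j = cycle_group \<Delta> j Mod boundaries \<Delta> j"


section \<open>Combinatorial and homological properties\<close>

definition simplex_complex :: "'a set set \<Rightarrow> bool" where
  "simplex_complex \<Delta> \<longleftrightarrow> facets \<Delta> = {\<Union>\<Delta>}"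

inductive vertex_decomposable :: "'a set set \<Rightarrow> bool" where
  simplex: "pure_complex \<Delta> \<Longrightarrow> simplex_complex \<Delta> \<Longrightarrow> vertex_decomposable \<Delta>"
| shedding: "pure_complex \<Delta> \<Longrightarrow> {x} \<in> \<Delta> \<Longrightarrow> vertex_decomposable (link \<Delta> {x}) \<Longrightarrow>
    vertex_decomposable (del \<Delta> {x}) \<Longrightarrow> vertex_decomposable \<Delta>"

definition shellable :: "'a set set \<Rightarrow> bool" where
  "shellable \<Delta> \<longleftrightarrow> pure_complex \<Delta> \<and>
    (\<exists>Fs. distinct Fs \<and> set Fs = facets \<Delta> \<and>
      (\<forall>r < length Fs. \<forall>j < r. \<exists>x \<in> Fs ! r - Fs ! j. \<exists>l < r. Fs ! r - Fs ! l = {x}))"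

definition cohen_macaulay :: "'k::field itself \<Rightarrow> 'a::linorder set set \<Rightarrow> bool" where
  "cohen_macaulay k \<Delta> \<longleftrightarrow> pure_complex \<Delta> \<and>
    (\<forall>F\<in>\<Delta>. \<forall>j < complex_dim (link \<Delta> F). trivial_group (reduced_homology k (link \<Delta> F) j))"

definition buchsbaum :: "'k::field itself \<Rightarrow> 'a::linorder set set \<Rightarrow> bool" where
  "buchsbaum k \<Delta> \<longleftrightarrow> pure_complex \<Delta> \<and>
    (\<forall>x. {x} \<in> \<Delta> \<longrightarrow> cohen_macaulay k (link \<Delta> {x}))"

definition graph_has :: "('a set set \<Rightarrow> bool) \<Rightarrow> 'a pair_pre_digraph \<Rightarrow> bool" where
  "graph_has P G \<longleftrightarrow> pure_complex (ind_complex G) \<and> P (ind_complex G)"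

end

theory Submission
  imports Defs
begin

text \<open>
  Distinct vertices of \<open>G\<close> are non-adjacent exactly when one is the other plus \<open>i\<close> modulo \<open>n\<close>.
  Hence \<open>Ind(G)\<close> is the clique complex of the graph in which \<open>v\<close> is joined to \<open>v + i\<close> and \<open>v - i\<close>
  modulo \<open>n\<close>, which is a disjoint union of \<open>gcd(i, n)\<close> cycles of length \<open>m = n / gcd(i, n)\<close>
  (single edges if \<open>m = 2\<close>).  If \<open>m = 3\<close>, that is \<open>n = 3i\<close>, every cycle is filled in to a
  triangle; otherwise no three vertices are pairwise non-adjacent.  So \<open>Ind(G)\<close> is pure, of
  dimension two if \<open>n = 3i\<close> and of dimension one otherwise, and it is connected if and only if
  \<open>gcd(i, n) = 1\<close>.

  Everything then reduces to connectedness.  In a pure complex of positive dimension each of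
  the three properties forces connectedness: the Cohen-Macaulay property because
  reduced homology in degree zero vanishes (\<open>connected_if_cohen_macaulay\<close>), shellability
  because a facet with at least two vertices cannot be the first to lie in a new component (\<open>connected_if_shellable\<close>), and vertex
  decomposability by induction, because deleting a vertex cannot remove the components that
  do not contain it (\<open>connected_if_vertex_decomposable\<close>).  Conversely, a connected pure complex
  of dimension one has all three (\<open>cohen_macaulay_if_connected\<close>,
  \<open>vertex_decomposable_if_connected\<close>, \<open>shellable_if_connected\<close>), and the remaining case
  \<open>i = 1\<close>, \<open>n = 3\<close> is a simplex.  The Buchsbaum property only sees links of vertices: these
  are finite sets of points in dimension one and edges in the case of triangles, hence
  Cohen-Macaulay whatever the number of components is.
\<close>

section \<open>Boundaries of chains\<close>

lemma finite_face:
  assumes "abstract_complex \<Delta>" "F \<in> \<Delta>"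
  shows "finite F"
  using assms by (metis Union_upper abstract_complex_def finite_subset)

lemma face_subset:
  assumes "abstract_complex \<Delta>" "F \<in> \<Delta>" "H \<subseteq> F"
  shows "H \<in> \<Delta>"
  using assms by (auto simp: abstract_complex_def)

lemma finite_complex:
  assumes "abstract_complex \<Delta>"
  shows "finite \<Delta>"
  using assms by (auto simp: abstract_complex_def intro: finite_UnionD)

lemma singleton_face_iff:
  assumes "abstract_complex \<Delta>"
  shows "{v} \<in> \<Delta> \<longleftrightarrow> v \<in> \<Union>\<Delta>"
  using assms by (auto intro: face_subset)

text \<open>
  The coefficient with which \<open>H\<close> occurs in the boundary of \<open>insert u H\<close>.
\<close>

definition position_sign :: "'a::linorder set \<Rightarrow> 'a \<Rightarrow> 'k::field" where
  "position_sign H u = (-1) ^ card {w \<in> H. w < u}"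

lemma position_sign_insert:
  assumes "finite H" "u \<notin> H" "u \<noteq> w"
  shows "position_sign (insert u H) w = (if u < w then - position_sign H w else position_sign H w)"
proof -
  have "{x \<in> insert u H. x < w} = (if u < w then insert u {x \<in> H. x < w} else {x \<in> H. x < w})"
    by auto
  then show ?thesis
    using assms by (auto simp: position_sign_def)
qed

text \<open>
  Reading the boundary at a face \<open>H\<close> as a sum over the vertices that can be added to \<open>H\<close>
  turns identities between chains into identities between finite sums over vertices.
\<close>

lemma chain_boundary_eq:
  fixes c :: "'a::linorder set \<Rightarrow> 'k::field"
  assumes \<Delta>: "abstract_complex \<Delta>" and c: "c \<in> chains \<Delta> j"
  shows "chain_boundary \<Delta> c H = (\<Sum>u\<in>\<Union>\<Delta> - H. position_sign H u * c (insert u H))"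
proof -
  let ?P = "{(F, v). F \<in> \<Delta> \<and> v \<in> F \<and> F - {v} = H}"
  let ?U = "{u \<in> \<Union>\<Delta> - H. insert u H \<in> \<Delta>}"
  have fin: "finite (\<Union>\<Delta>)" "finite \<Delta>"
    using \<Delta> finite_complex by (auto simp: abstract_complex_def)
  have fin_face: "\<forall>F\<in>\<Delta>. finite F"
    using \<Delta> finite_face by blast
  have "chain_boundary \<Delta> c H = (\<Sum>(F, v)\<in>Sigma \<Delta> (\<lambda>F. F).
      if F - {v} = H then (-1) ^ card {u \<in> F. u < v} * c F else 0)"
    unfolding chain_boundary_def using fin fin_face by (intro sum.Sigma) blast+
  also have "\<dots> = (\<Sum>(F, v)\<in>?P. (-1) ^ card {u \<in> F. u < v} * c F)"
  proof (rule sum.mono_neutral_cong_right)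
    show "finite (Sigma \<Delta> (\<lambda>F. F))" using fin fin_face by (intro finite_SigmaI) blast+
  qed (auto split: if_splits)
  also have "\<dots> = (\<Sum>u\<in>?U. position_sign H u * c (insert u H))"
  proof (rule sum.reindex_bij_witness[of _ "\<lambda>u. (insert u H, u)" snd])
    fix p assume "p \<in> ?P"
    moreover have "{u \<in> F. u < v} = {u \<in> F - {v}. u < v}" for F and v :: 'a
      by auto
    ultimately show "position_sign H (snd p) * c (insert (snd p) H) =
        (case p of (F, v) \<Rightarrow> (-1) ^ card {u \<in> F. u < v} * c F)"
      by (auto simp: position_sign_def insert_absorb)
  qed (auto simp: insert_absorb)
  also have "\<dots> = (\<Sum>u\<in>\<Union>\<Delta> - H. position_sign H u * c (insert u H))"
    using fin c by (intro sum.mono_neutral_left) (auto simp: chains_def)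
  finally show ?thesis .
qed

lemma chain_boundary_in_chains:
  fixes c :: "'a::linorder set \<Rightarrow> 'k::field"
  assumes \<Delta>: "abstract_complex \<Delta>" and c: "c \<in> chains \<Delta> (j + 1)"
  shows "chain_boundary \<Delta> c \<in> chains \<Delta> j"
  unfolding chains_def
proof (clarify, goal_cases)
  case (1 H)
  then obtain u where u: "u \<notin> H" "c (insert u H) \<noteq> 0"
    unfolding chain_boundary_eq[OF \<Delta> c] by (metis (no_types, lifting) DiffD2 mult_zero_right sum.neutral)
  then have "insert u H \<in> \<Delta>" "face_dim (insert u H) = j + 1"
    using c by (auto simp: chains_def)
  moreover from this have "H \<in> \<Delta>"
    using \<Delta> face_subset by blast
  ultimately show ?case
    using u finite_face[OF \<Delta>] by (auto simp: face_dim_def)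
qed

lemma sum_off_diagonal_antisymmetric:
  fixes f :: "'a \<Rightarrow> 'a \<Rightarrow> 'b::ab_group_add"
  assumes "finite X" and "\<And>u w. u \<in> X \<Longrightarrow> w \<in> X \<Longrightarrow> u \<noteq> w \<Longrightarrow> f u w = - f w u"
  shows "(\<Sum>u\<in>X. \<Sum>w\<in>X - {u}. f u w) = 0"
  using assms
proof (induction X)
  case (insert x X)
  have row: "(\<Sum>w\<in>insert x X - {u}. f u w) = f u x + (\<Sum>w\<in>X - {u}. f u w)" if "u \<in> X" for u
  proof -
    have "insert x X - {u} = insert x (X - {u})" using that insert.hyps by auto
    then show ?thesis using insert.hyps by simp
  qed
  have first: "(\<Sum>w\<in>insert x X - {x}. f x w) = (\<Sum>w\<in>X. f x w)"
    using insert.hyps by simp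
  have "(\<Sum>w\<in>X. f x w) = - (\<Sum>u\<in>X. f u x)"
    unfolding sum_negf[symmetric] using insert.hyps by (intro sum.cong refl insert.prems) auto
  moreover have "(\<Sum>u\<in>X. \<Sum>w\<in>X - {u}. f u w) = 0"
    by (rule insert.IH, rule insert.prems) auto
  ultimately show ?case
    using insert.hyps by (simp add: row first sum.distrib)
qed simp

text \<open>
  A face \<open>H\<close> together with two further vertices occurs twice in the double boundary, once for
  each order in which the two vertices are removed, and with opposite signs.
\<close>

lemma chain_boundary_boundary:
  fixes c :: "'a::linorder set \<Rightarrow> 'k::field"
  assumes \<Delta>: "abstract_complex \<Delta>" and c: "c \<in> chains \<Delta> (j + 1)"
  shows "chain_boundary \<Delta> (chain_boundary \<Delta> c) = (\<lambda>_. 0)"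
proof
  fix H
  have bd: "chain_boundary \<Delta> c \<in> chains \<Delta> ((j - 1) + 1)"
    using chain_boundary_in_chains[OF \<Delta> c] by simp
  let ?f = "\<lambda>u w. position_sign H u * (position_sign (insert u H) w * c (insert w (insert u H)))"
  show "chain_boundary \<Delta> (chain_boundary \<Delta> c) H = 0"
  proof (cases "H \<in> \<Delta>")
    case True
    have "chain_boundary \<Delta> (chain_boundary \<Delta> c) H =
        (\<Sum>u\<in>\<Union>\<Delta> - H. \<Sum>w\<in>\<Union>\<Delta> - insert u H. ?f u w)"
      unfolding chain_boundary_eq[OF \<Delta> bd] chain_boundary_eq[OF \<Delta> c] by (simp add: sum_distrib_left)
    also have "\<dots> = (\<Sum>u\<in>\<Union>\<Delta> - H. \<Sum>w\<in>(\<Union>\<Delta> - H) - {u}. ?f u w)"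
      by (intro sum.cong refl) auto
    also have "\<dots> = 0"
    proof (rule sum_off_diagonal_antisymmetric)
      show "finite (\<Union>\<Delta> - H)" using \<Delta> by (auto simp: abstract_complex_def)
      show "?f u w = - ?f w u" if "u \<in> \<Union>\<Delta> - H" "w \<in> \<Union>\<Delta> - H" "u \<noteq> w" for u w
      proof -
        have "insert w (insert u H) = insert u (insert w H)" by auto
        moreover have "u < w \<and> \<not> w < u \<or> \<not> u < w \<and> w < u"
          using that by auto
        ultimately show ?thesis
          using that finite_face[OF \<Delta> True] by (elim disjE) (simp_all add: position_sign_insert)
      qed
    qed
    finally show ?thesis .
  next
    case False
    then show ?thesis
      using chain_boundary_in_chains[OF \<Delta> bd] by (auto simp: chains_def)
  qed
qed

lemma chain_boundary_add:
  "chain_boundary \<Delta> (\<lambda>F. c F + d F) = (\<lambda>H. chain_boundary \<Delta> c H + chain_boundary \<Delta> d H)"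
  unfolding chain_boundary_def sum.distrib[symmetric]
  by (intro ext sum.cong refl) (auto simp: algebra_simps)

lemma chain_boundary_scale:
  "chain_boundary \<Delta> (\<lambda>F. a * c F) = (\<lambda>H. a * chain_boundary \<Delta> c H)"
  unfolding chain_boundary_def
  by (intro ext) (simp add: sum_distrib_left, intro sum.cong refl, auto simp: mult_ac)

lemma chain_boundary_zero [simp]: "chain_boundary \<Delta> (\<lambda>_. 0) = (\<lambda>_. 0)"
  unfolding chain_boundary_def by (intro ext sum.neutral ballI) auto

lemma zero_in_chains [simp]: "(\<lambda>_. 0) \<in> chains \<Delta> j"
  by (simp add: chains_def)

lemma add_in_chains: "c \<in> chains \<Delta> j \<Longrightarrow> d \<in> chains \<Delta> j \<Longrightarrow> (\<lambda>F. c F + d F) \<in> chains \<Delta> j"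
  unfolding chains_def mem_Collect_eq by (metis add.right_neutral)

lemma scale_in_chains: "c \<in> chains \<Delta> j \<Longrightarrow> (\<lambda>F. a * c F) \<in> chains \<Delta> j"
  by (auto simp: chains_def)

lemma boundariesI: "d \<in> chains \<Delta> (j + 1) \<Longrightarrow> chain_boundary \<Delta> d = c \<Longrightarrow> c \<in> boundaries \<Delta> j"
  by (auto simp: boundaries_def)

lemma zero_in_boundaries [simp]: "(\<lambda>_. 0) \<in> boundaries \<Delta> j"
  unfolding boundaries_def by (rule image_eqI[of _ _ "\<lambda>_. 0"]) auto

lemma add_in_boundaries:
  assumes "c \<in> boundaries \<Delta> j" "d \<in> boundaries \<Delta> j"
  shows "(\<lambda>F. c F + d F) \<in> boundaries \<Delta> j"
proof -
  obtain c' d' where "c' \<in> chains \<Delta> (j + 1)" "d' \<in> chains \<Delta> (j + 1)"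
    "c = chain_boundary \<Delta> c'" "d = chain_boundary \<Delta> d'"
    using assms by (auto simp: boundaries_def)
  then show ?thesis
    unfolding boundaries_def
    by (intro image_eqI[of _ _ "\<lambda>F. c' F + d' F"]) (auto simp: chain_boundary_add add_in_chains)
qed

lemma scale_in_boundaries:
  assumes "c \<in> boundaries \<Delta> j"
  shows "(\<lambda>F. a * c F) \<in> boundaries \<Delta> j"
proof -
  obtain c' where "c' \<in> chains \<Delta> (j + 1)" "c = chain_boundary \<Delta> c'"
    using assms by (auto simp: boundaries_def)
  then show ?thesis
    unfolding boundaries_def
    by (intro image_eqI[of _ _ "\<lambda>F. a * c' F"]) (auto simp: chain_boundary_scale scale_in_chains)
qed

lemma sum_in_boundaries:
  assumes "\<And>x. x \<in> X \<Longrightarrow> f x \<in> boundaries \<Delta> j"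
  shows "(\<lambda>F. \<Sum>x\<in>X. f x F) \<in> boundaries \<Delta> j"
  using assms by (induction X rule: infinite_finite_induct) (auto simp: add_in_boundaries)

lemma boundaries_subset_cycles:
  assumes "abstract_complex \<Delta>"
  shows "boundaries \<Delta> j \<subseteq> cycles \<Delta> j"
  using chain_boundary_in_chains[OF assms] chain_boundary_boundary[OF assms]
  by (auto simp: boundaries_def cycles_def)

section \<open>Vanishing of reduced homology\<close>

lemma comm_group_cycle_group: "comm_group (cycle_group \<Delta> j)"
proof (rule comm_groupI)
  fix c assume "c \<in> carrier (cycle_group \<Delta> j)"
  then have "(\<lambda>F. - 1 * c F) \<in> cycles \<Delta> j"
    using scale_in_chains[of c \<Delta> j "-1"] chain_boundary_scale[of \<Delta> "-1" c]
    by (simp add: cycle_group_def cycles_def)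
  then show "\<exists>d\<in>carrier (cycle_group \<Delta> j). d \<otimes>\<^bsub>cycle_group \<Delta> j\<^esub> c = \<one>\<^bsub>cycle_group \<Delta> j\<^esub>"
    by (intro bexI[of _ "\<lambda>F. - 1 * c F"]) (auto simp: cycle_group_def)
qed (auto simp: cycle_group_def cycles_def chain_boundary_add add_in_chains algebra_simps)

text \<open>
  As boundaries are cycles in every complex, vanishing of the quotient group can be stated
  without cosets from here on.
\<close>

lemma trivial_reduced_homology_iff:
  fixes k :: "'k::field itself"
  assumes \<Delta>: "abstract_complex \<Delta>"
  shows "trivial_group (reduced_homology k \<Delta> j) \<longleftrightarrow>
    (cycles \<Delta> j :: ('a::linorder set \<Rightarrow> 'k) set) \<subseteq> boundaries \<Delta> j"
proof -
  let ?G = "cycle_group \<Delta> j :: ('a set \<Rightarrow> 'k) monoid"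
  let ?B = "boundaries \<Delta> j :: ('a set \<Rightarrow> 'k) set"
  interpret comm_group ?G by (rule comm_group_cycle_group)
  have image_singleton: "f ` X = {b} \<longleftrightarrow> (\<forall>x\<in>X. f x = b)" if "X \<noteq> {}"
    for f :: "('a set \<Rightarrow> 'k) \<Rightarrow> ('a set \<Rightarrow> 'k) set" and X b
    using that by auto
  have carrier: "carrier ?G = cycles \<Delta> j" by (simp add: cycle_group_def)
  have sub: "subgroup ?B ?G"
  proof (rule subgroupI)
    show "?B \<subseteq> carrier ?G" using boundaries_subset_cycles[OF \<Delta>] by (simp add: carrier)
    show "?B \<noteq> {}" using zero_in_boundaries by blast
    show "inv\<^bsub>?G\<^esub> c \<in> ?B" if "c \<in> ?B" for c
    proof -
      have "(\<lambda>F. - 1 * c F) \<in> ?B" using that by (rule scale_in_boundaries)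
      moreover have "inv\<^bsub>?G\<^esub> c = (\<lambda>F. - 1 * c F)"
        using that calculation boundaries_subset_cycles[OF \<Delta>, of j]
        by (intro inv_equality) (auto simp: cycle_group_def)
      ultimately show ?thesis by simp
    qed
    show "c \<otimes>\<^bsub>?G\<^esub> d \<in> ?B" if "c \<in> ?B" "d \<in> ?B" for c d
      using that by (auto simp: cycle_group_def add_in_boundaries)
  qed
  have "group (?G Mod ?B)"
    using sub by (intro normal.factorgroup_is_group) (simp add: normal_iff_subgroup)
  then have "trivial_group (reduced_homology k \<Delta> j) \<longleftrightarrow> (\<forall>c\<in>carrier ?G. ?B #>\<^bsub>?G\<^esub> c = ?B)"
    using image_singleton[OF carrier_not_empty]
    by (simp add: trivial_group_def reduced_homology_def carrier_FactGroup)
  also have "\<dots> \<longleftrightarrow> carrier ?G \<subseteq> ?B"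
  proof -
    have "?B #>\<^bsub>?G\<^esub> c = ?B \<longleftrightarrow> c \<in> ?B" if "c \<in> carrier ?G" for c
      using coset_join1[of ?B c] coset_join2[of c ?B] that sub subgroup.subset[OF sub] by blast
    then show ?thesis by blast
  qed
  finally show ?thesis by (simp add: carrier)
qed

definition elementary_chain :: "'a set \<Rightarrow> 'a set \<Rightarrow> 'k::field" where
  "elementary_chain F = (\<lambda>H. if H = F then 1 else 0)"

lemma elementary_chain_in_chains:
  "F \<in> \<Delta> \<Longrightarrow> face_dim F = j \<Longrightarrow> elementary_chain F \<in> chains \<Delta> j"
  by (auto simp: elementary_chain_def chains_def split: if_splits)

lemma chain_boundary_elementary:
  assumes "abstract_complex \<Delta>" "F \<in> \<Delta>"
  shows "chain_boundary \<Delta> (elementary_chain F) =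
    (\<lambda>H. \<Sum>v\<in>F. if F - {v} = H then (-1) ^ card {u \<in> F. u < v} else 0)"
proof
  fix H
  have "chain_boundary \<Delta> (elementary_chain F) H =
      (\<Sum>F'\<in>\<Delta>. if F' = F then (\<Sum>v\<in>F. if F - {v} = H then (-1) ^ card {u \<in> F. u < v} else 0) else 0)"
    unfolding chain_boundary_def elementary_chain_def
    by (intro sum.cong refl) (simp cong: if_cong)
  then show "chain_boundary \<Delta> (elementary_chain F) H =
      (\<Sum>v\<in>F. if F - {v} = H then (-1) ^ card {u \<in> F. u < v} else 0)"
    using assms finite_complex[OF assms(1)] by simp
qed

lemma chain_boundary_vertex:
  assumes "abstract_complex \<Delta>" "{v} \<in> \<Delta>"
  shows "chain_boundary \<Delta> (elementary_chain {v}) = elementary_chain {}"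
  unfolding chain_boundary_elementary[OF assms]
  by (intro ext) (auto simp: elementary_chain_def cong: conj_cong)

lemma chain_boundary_edge:
  assumes "abstract_complex \<Delta>" "{a, b} \<in> \<Delta>" "a < b"
  shows "chain_boundary \<Delta> (elementary_chain {a, b}) =
    (\<lambda>H. elementary_chain {b} H - elementary_chain {a} H :: 'b::field)"
proof -
  have ab: "{a, b} - {a} = {b}" "{a, b} - {b} = {a}"
    "{u \<in> {a, b}. u < a} = {}" "{u \<in> {a, b}. u < b} = {a}"
    using assms(3) by auto
  have two: "(\<Sum>v\<in>{a, b}. f v) = f a + f b" for f :: "'a \<Rightarrow> 'b"
    using assms(3) by simp
  show ?thesis
    unfolding chain_boundary_elementary[OF assms(1,2)] two ab
    using assms(3) by (intro ext) (simp add: elementary_chain_def eq_commute)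
qed

lemma complex_dim_greater_iff:
  assumes "abstract_complex \<Delta>"
  shows "j < complex_dim \<Delta> \<longleftrightarrow> (\<exists>F\<in>\<Delta>. j < face_dim F)"
  unfolding complex_dim_def using assms finite_complex[OF assms]
  by (subst Max_gr_iff) (auto simp: abstract_complex_def)

lemma trivial_homology_below_minus_one:
  fixes k :: "'k::field itself" and \<Delta> :: "'a::linorder set set"
  assumes "abstract_complex \<Delta>" "j < -1"
  shows "trivial_group (reduced_homology k \<Delta> j)"
proof -
  have "c = (\<lambda>_. 0)" if "c \<in> chains \<Delta> j" for c :: "'a set \<Rightarrow> 'k"
    using that assms(2) by (auto simp: chains_def face_dim_def)
  then show ?thesis
    unfolding trivial_reduced_homology_iff[OF assms(1)] cycles_def
    using zero_in_boundaries by blast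
qed

lemma trivial_homology_minus_one:
  fixes k :: "'k::field itself" and \<Delta> :: "'a::linorder set set"
  assumes \<Delta>: "abstract_complex \<Delta>" and v: "{v} \<in> \<Delta>"
  shows "trivial_group (reduced_homology k \<Delta> (-1))"
  unfolding trivial_reduced_homology_iff[OF \<Delta>]
proof
  fix c :: "'a set \<Rightarrow> 'k" assume c: "c \<in> cycles \<Delta> (-1)"
  have "elementary_chain {v} \<in> chains \<Delta> (-1 + 1)"
    using v by (intro elementary_chain_in_chains) (simp_all add: face_dim_def)
  then have "elementary_chain {} \<in> boundaries \<Delta> (-1)"
    by (rule boundariesI) (rule chain_boundary_vertex[OF assms])
  then have boundary: "(\<lambda>H. c {} * elementary_chain {} H) \<in> boundaries \<Delta> (-1)"
    by (rule scale_in_boundaries)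
  have decomposition: "c H = c {} * elementary_chain {} H" for H
  proof (cases "H = {}")
    case False
    then have "c H = 0"
      using c finite_face[OF \<Delta>, of H] by (auto simp: cycles_def chains_def face_dim_def)
    then show ?thesis using False by (simp add: elementary_chain_def)
  qed (simp add: elementary_chain_def)
  have "(\<lambda>H. c {} * elementary_chain {} H) = c" by (rule ext) (rule decomposition[symmetric])
  with boundary show "c \<in> boundaries \<Delta> (-1)" by simp
qed

text \<open>
  Connectedness is expressed by vertex sets that split no face, that is, by unions of
  components.  In this form it can be used and proved without handling paths.
\<close>

definition connected_complex :: "'a set set \<Rightarrow> bool" where
  "connected_complex \<Delta> \<longleftrightarrow>
    (\<forall>A. (\<forall>F\<in>\<Delta>. F \<subseteq> A \<or> F \<inter> A = {}) \<longrightarrow> \<Union>\<Delta> \<subseteq> A \<or> \<Union>\<Delta> \<inter> A = {})"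

lemma augmentation_eq_boundary:
  fixes c :: "'a::linorder set \<Rightarrow> 'k::field"
  assumes "abstract_complex \<Delta>" "c \<in> chains \<Delta> j"
  shows "chain_boundary \<Delta> c {} = (\<Sum>v\<in>\<Union>\<Delta>. c {v})"
  by (simp add: chain_boundary_eq[OF assms] position_sign_def)

text \<open>
  The vertices that differ from a base vertex \<open>r\<close> by a boundary form a union of components,
  so in a connected complex they are all the vertices.  A cycle of degree zero has coefficient
  sum zero and is therefore a combination of such differences.
\<close>

lemma trivial_homology_zero_if_connected:
  fixes k :: "'k::field itself" and \<Delta> :: "'a::linorder set set"
  assumes \<Delta>: "abstract_complex \<Delta>" and conn: "connected_complex \<Delta>" and r: "{r} \<in> \<Delta>"
  shows "trivial_group (reduced_homology k \<Delta> 0)"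
  unfolding trivial_reduced_homology_iff[OF \<Delta>]
proof
  fix c :: "'a set \<Rightarrow> 'k" assume c: "c \<in> cycles \<Delta> 0"
  define diff where "diff a b = (\<lambda>H. elementary_chain {a} H - elementary_chain {b} H :: 'k)" for a b :: 'a
  have edge: "diff b a \<in> boundaries \<Delta> 0" if "{a, b} \<in> \<Delta>" for a b
  proof -
    have less: "diff b a \<in> boundaries \<Delta> 0" if "a < b" "{a, b} \<in> \<Delta>" for a b
    proof -
      have "elementary_chain {a, b} \<in> chains \<Delta> (0 + 1)"
        using that by (intro elementary_chain_in_chains) (simp_all add: face_dim_def)
      then show ?thesis
        unfolding diff_def by (rule boundariesI) (rule chain_boundary_edge[OF \<Delta> that(2,1)])
    qed
    have swap: "diff b a = (\<lambda>H. -1 * diff a b H)"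
      by (auto simp: diff_def)
    consider "a < b" | "b < a" | "a = b" by force
    then show ?thesis
    proof cases
      case 2
      then have "(\<lambda>H. -1 * diff a b H) \<in> boundaries \<Delta> 0"
        using that by (intro scale_in_boundaries less) (simp_all add: insert_commute)
      then show ?thesis using swap by simp
    next
      case 3
      then have "diff b a = (\<lambda>_. 0)" by (simp add: diff_def)
      then show ?thesis by simp
    qed (use less that in blast)
  qed
  define A where "A = {v. diff v r \<in> boundaries \<Delta> 0}"
  have "F \<subseteq> A \<or> F \<inter> A = {}" if F: "F \<in> \<Delta>" for F
  proof -
    have "b \<in> A" if "a \<in> F \<inter> A" "b \<in> F" for a b
    proof -
      have "{a, b} \<in> \<Delta>"
        using that F by (auto intro: face_subset[OF \<Delta>])
      then have "(\<lambda>H. diff b a H + diff a r H) \<in> boundaries \<Delta> 0"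
        using that by (intro add_in_boundaries edge[of a b]) (auto simp: A_def)
      moreover have "(\<lambda>H. diff b a H + diff a r H) = diff b r"
        by (auto simp: diff_def)
      ultimately show ?thesis by (simp add: A_def)
    qed
    then show ?thesis by blast
  qed
  moreover have "r \<in> \<Union>\<Delta> \<inter> A"
    using r edge[of r r] by (auto simp: A_def)
  ultimately have A: "\<Union>\<Delta> \<subseteq> A"
    using conn by (auto simp: connected_complex_def)
  have fin: "finite (\<Union>\<Delta>)" using \<Delta> by (simp add: abstract_complex_def)
  have aug: "(\<Sum>v\<in>\<Union>\<Delta>. c {v}) = 0"
    using c augmentation_eq_boundary[OF \<Delta>, of c 0] by (simp add: cycles_def)
  have "(\<Sum>v\<in>\<Union>\<Delta>. c {v} * diff v r H) = c H" for H
  proof -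
    have "(\<Sum>v\<in>\<Union>\<Delta>. c {v} * diff v r H) =
        (\<Sum>v\<in>\<Union>\<Delta>. c {v} * elementary_chain {v} H) - (\<Sum>v\<in>\<Union>\<Delta>. c {v}) * elementary_chain {r} H"
      by (simp add: diff_def right_diff_distrib sum_subtractf sum_distrib_right)
    also have "\<dots> = (\<Sum>v\<in>\<Union>\<Delta>. if H = {v} then c {v} else 0)"
      by (simp add: aug elementary_chain_def if_distrib cong: if_cong)
    also have "\<dots> = c H"
    proof (cases "\<exists>w\<in>\<Union>\<Delta>. H = {w}")
      case True
      then obtain w where "w \<in> \<Union>\<Delta>" "H = {w}" by blast
      then show ?thesis using fin by simp
    next
      case False
      have "c H = 0"
      proof (rule ccontr)
        assume "c H \<noteq> 0"
        then have "H \<in> \<Delta>" "card H = 1" using c by (auto simp: cycles_def chains_def face_dim_def)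
        then show False using False by (auto simp: card_1_singleton_iff)
      qed
      moreover have "(\<Sum>v\<in>\<Union>\<Delta>. if H = {v} then c {v} else 0) = 0"
        using False by (intro sum.neutral) auto
      ultimately show ?thesis by simp
    qed
    finally show ?thesis .
  qed
  moreover have "(\<lambda>H. \<Sum>v\<in>\<Union>\<Delta>. c {v} * diff v r H) \<in> boundaries \<Delta> 0"
    using A by (intro sum_in_boundaries scale_in_boundaries) (auto simp: A_def)
  ultimately show "c \<in> boundaries \<Delta> 0" by simp
qed

text \<open>
  If \<open>A\<close> is a union of components containing \<open>a\<close> but not \<open>b\<close>, the difference of the two
  vertices is a cycle.  Were it the boundary of a chain \<open>d\<close>, cutting \<open>d\<close> down to the edges in
  \<open>A\<close> would give a chain whose boundary is the vertex \<open>a\<close> alone.  This is impossible, because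
  the coefficients of a boundary sum to zero.
\<close>

lemma connected_if_trivial_homology_zero:
  fixes k :: "'k::field itself" and \<Delta> :: "'a::linorder set set"
  assumes \<Delta>: "abstract_complex \<Delta>" and triv: "trivial_group (reduced_homology k \<Delta> 0)"
  shows "connected_complex \<Delta>"
  unfolding connected_complex_def
proof (intro allI impI, rule ccontr)
  fix A assume sep: "\<forall>F\<in>\<Delta>. F \<subseteq> A \<or> F \<inter> A = {}" and "\<not> (\<Union>\<Delta> \<subseteq> A \<or> \<Union>\<Delta> \<inter> A = {})"
  then have "\<exists>a\<in>\<Union>\<Delta>. a \<in> A" "\<exists>b\<in>\<Union>\<Delta>. b \<notin> A" by blast+
  then obtain a b where ab: "a \<in> \<Union>\<Delta>" "a \<in> A" "b \<in> \<Union>\<Delta>" "b \<notin> A" by blast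
  have fin: "finite (\<Union>\<Delta>)" using \<Delta> by (simp add: abstract_complex_def)
  define c where "c = (\<lambda>H. elementary_chain {a} H + -1 * elementary_chain {b} H :: 'k)"
  have vertices: "{a} \<in> \<Delta>" "{b} \<in> \<Delta>"
    using ab by (simp_all add: singleton_face_iff[OF \<Delta>])
  have "c \<in> chains \<Delta> 0"
    unfolding c_def using vertices
    by (intro add_in_chains scale_in_chains elementary_chain_in_chains) (simp_all add: face_dim_def)
  moreover have "chain_boundary \<Delta> c = (\<lambda>_. 0)"
    unfolding c_def chain_boundary_add chain_boundary_scale
    by (simp add: chain_boundary_vertex[OF \<Delta>] vertices)
  ultimately have "c \<in> boundaries \<Delta> 0"
    using triv unfolding trivial_reduced_homology_iff[OF \<Delta>] cycles_def by blast
  then obtain d where d: "d \<in> chains \<Delta> (0 + 1)" "c = chain_boundary \<Delta> d"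
    by (auto simp: boundaries_def)
  \<comment> \<open>The boundary of \<open>e\<close> is the part of \<open>c\<close> supported on \<open>A\<close>, because no face crosses \<open>A\<close>.\<close>
  define e where "e F = (if F \<subseteq> A then d F else 0)" for F
  have e: "e \<in> chains \<Delta> (0 + 1)"
    using d(1) by (auto simp: e_def chains_def)
  have "e (insert u {v}) = (if v \<in> A then d (insert u {v}) else 0)" for u v
  proof (cases "insert u {v} \<in> \<Delta>")
    case True
    then show ?thesis using sep by (auto simp: e_def)
  next
    case False
    then have "d (insert u {v}) = 0" using d(1) by (auto simp: chains_def)
    then show ?thesis by (simp add: e_def)
  qed
  then have "chain_boundary \<Delta> e {v} = (if v \<in> A then c {v} else 0)" for v
    unfolding d(2) chain_boundary_eq[OF \<Delta> e] chain_boundary_eq[OF \<Delta> d(1)] by simp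
  moreover have "(\<Sum>v\<in>\<Union>\<Delta>. chain_boundary \<Delta> e {v}) = 0"
    using augmentation_eq_boundary[OF \<Delta> chain_boundary_in_chains[OF \<Delta> e]]
      chain_boundary_boundary[OF \<Delta> e] by simp
  moreover have "(if v \<in> A then c {v} else 0) = (if v = a then 1 else 0)" for v
    using ab by (auto simp: c_def elementary_chain_def)
  ultimately have "(\<Sum>v\<in>\<Union>\<Delta>. if v = a then 1 else 0 :: 'k) = 0" by (simp only:)
  then show False using ab(1) fin by simp
qed

text \<open>
  Coning off from the least vertex \<open>v\<close> is a contraction: if \<open>d\<close> takes the value \<open>c (F - {v})\<close> on
  faces containing \<open>v\<close> and vanishes elsewhere, then \<open>c\<close> is the boundary of \<open>d\<close> as soon as \<open>c\<close>
  is a cycle.  The choice of the least vertex makes the signs simple: \<open>v\<close> itself gets the sign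
  one, and adding \<open>v\<close> to a face flips the sign of every other vertex.
\<close>

lemma trivial_homology_simplex:
  fixes k :: "'k::field itself" and \<Delta> :: "'a::linorder set set"
  assumes \<Delta>: "abstract_complex \<Delta>" and V: "\<Union>\<Delta> \<in> \<Delta>" "\<Union>\<Delta> \<noteq> {}"
  shows "trivial_group (reduced_homology k \<Delta> j)"
  unfolding trivial_reduced_homology_iff[OF \<Delta>]
proof
  fix c :: "'a set \<Rightarrow> 'k" assume "c \<in> cycles \<Delta> j"
  then have c: "c \<in> chains \<Delta> j" "chain_boundary \<Delta> c = (\<lambda>_. 0)"
    by (auto simp: cycles_def)
  have fin: "finite (\<Union>\<Delta>)" using \<Delta> by (simp add: abstract_complex_def)
  define v where "v = Min (\<Union>\<Delta>)"
  have v: "v \<in> \<Union>\<Delta>" "\<And>u. u \<in> \<Union>\<Delta> \<Longrightarrow> v \<le> u"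
    unfolding v_def using Min_in[OF fin V(2)] Min_le[OF fin] by blast+
  define d where "d F = (if v \<in> F then c (F - {v}) else 0)" for F
  have d: "d \<in> chains \<Delta> (j + 1)"
    unfolding chains_def
  proof (clarify, goal_cases)
    case (1 F)
    then have *: "v \<in> F" "F - {v} \<in> \<Delta>" "face_dim (F - {v}) = j"
      using c(1) by (auto simp: d_def chains_def split: if_splits)
    then have "F \<subseteq> \<Union>\<Delta>" using v(1) by blast
    then have "F \<in> \<Delta>" by (rule face_subset[OF \<Delta> V(1)])
    moreover from this have "finite F" by (rule finite_face[OF \<Delta>])
    then have "card F = Suc (card (F - {v}))" using * by (metis card.remove)
    ultimately show ?case using * by (simp add: face_dim_def)
  qed
  have sign_v: "position_sign H v = (1 :: 'k)" if "H \<in> \<Delta>" for H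
  proof -
    have "\<not> w < v" if "w \<in> H" for w
      using v(2)[OF UnionI[OF \<open>H \<in> \<Delta>\<close> that]] by (rule leD)
    then have "{w \<in> H. w < v} = {}" by blast
    then show ?thesis unfolding position_sign_def by (simp only: card.empty power_0)
  qed
  have "chain_boundary \<Delta> d H = c H" for H
  proof (cases "H \<in> \<Delta>")
    case False
    then have "chain_boundary \<Delta> d H = 0"
      using chain_boundary_in_chains[OF \<Delta> d] by (auto simp: chains_def)
    then show ?thesis using False c(1) by (auto simp: chains_def)
  next
    case H: True
    show ?thesis
    proof (cases "v \<in> H")
      case False
      have "chain_boundary \<Delta> d H = (\<Sum>u\<in>\<Union>\<Delta> - H. if u = v then c H else 0)"
        unfolding chain_boundary_eq[OF \<Delta> d]
        using False sign_v[OF H] by (intro sum.cong refl) (auto simp: d_def)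
      then show ?thesis using False v(1) fin by simp
    next
      case True
      define K where "K = H - {v}"
      have K: "v \<notin> K" "H = insert v K" "K \<in> \<Delta>"
        using True H by (auto simp: K_def intro: face_subset[OF \<Delta>])
      have "chain_boundary \<Delta> d H = (\<Sum>u\<in>\<Union>\<Delta> - H. - (position_sign K u * c (insert u K)))"
        unfolding chain_boundary_eq[OF \<Delta> d]
      proof (intro sum.cong refl)
        fix u assume u: "u \<in> \<Union>\<Delta> - H"
        then have "v < u" using v(2)[of u] True by (cases "u = v") auto
        then have "position_sign H u = - (position_sign K u :: 'k)"
          using K finite_face[OF \<Delta> K(3)] by (simp add: position_sign_insert)
        moreover have "d (insert u H) = c (insert u K)"
        proof -
          have "insert u H - {v} = insert u K" "v \<in> insert u H" using u True by (auto simp: K_def)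
          then show ?thesis by (simp only: d_def if_True)
        qed
        ultimately show "position_sign H u * d (insert u H) = - (position_sign K u * c (insert u K))"
          by simp
      qed
      \<comment> \<open>The sum is the boundary of \<open>c\<close> at \<open>K\<close> with the term of \<open>v\<close> left out.\<close>
      also have "\<dots> = position_sign K v * c (insert v K) - chain_boundary \<Delta> c K"
      proof -
        have "\<Union>\<Delta> - K = insert v (\<Union>\<Delta> - H)" "v \<notin> \<Union>\<Delta> - H" using K v(1) by auto
        then show ?thesis
          unfolding chain_boundary_eq[OF \<Delta> c(1)] using fin by (simp add: sum_negf)
      qed
      finally show ?thesis using K by (simp add: c(2) sign_v)
    qed
  qed
  then have "chain_boundary \<Delta> d = c" by auto
  then show "c \<in> boundaries \<Delta> j" using d by (auto simp: boundaries_def)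
qed

section \<open>Pure complexes, links and deletions\<close>

lemma face_in_facet:
  assumes "abstract_complex \<Delta>" "F \<in> \<Delta>"
  obtains H where "H \<in> facets \<Delta>" "F \<subseteq> H"
proof -
  obtain H where H: "H \<in> \<Delta>" "F \<subseteq> H \<and> (\<forall>K\<in>\<Delta>. H \<subseteq> K \<longrightarrow> H = K)"
    using finite_has_maximal2[OF finite_complex[OF assms(1)] assms(2)] by (rule bexE)
  then have "H \<in> facets \<Delta>" unfolding facets_def by (simp add: eq_commute)
  then show thesis using H(2) that by simp
qed

lemma pure_complexI:
  assumes "abstract_complex \<Delta>" and "\<And>F. F \<in> \<Delta> \<Longrightarrow> \<exists>H\<in>\<Delta>. F \<subseteq> H \<and> card H = d"
  shows "pure_complex \<Delta>" and "\<forall>F\<in>facets \<Delta>. card F = d"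
proof -
  show "\<forall>F\<in>facets \<Delta>. card F = d"
  proof
    fix F assume "F \<in> facets \<Delta>"
    then have F: "F \<in> \<Delta>" "\<And>H. H \<in> \<Delta> \<Longrightarrow> F \<subseteq> H \<Longrightarrow> H = F" by (simp_all add: facets_def)
    obtain H where "H \<in> \<Delta>" "F \<subseteq> H" "card H = d" using assms(2)[OF F(1)] by blast
    then show "card F = d" using F(2)[of H] by simp
  qed
  then show "pure_complex \<Delta>"
    using assms(1) by (simp add: pure_complex_def face_dim_def)
qed

lemma pure_complex_card_facets:
  assumes "pure_complex \<Delta>" "F \<in> facets \<Delta>" "H \<in> facets \<Delta>"
  shows "card F = card H"
proof -
  have "face_dim F = face_dim H"
    using assms unfolding pure_complex_def by blast
  then show ?thesis by (simp add: face_dim_def)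
qed

lemma pure_simplex:
  assumes "abstract_complex \<Delta>" "\<Union>\<Delta> \<in> \<Delta>"
  shows "facets \<Delta> = {\<Union>\<Delta>}" "pure_complex \<Delta>"
proof -
  show "facets \<Delta> = {\<Union>\<Delta>}"
    using assms(2) unfolding facets_def by blast
  then show "pure_complex \<Delta>"
    using assms(1) by (simp add: pure_complex_def)
qed

lemma link_empty [simp]: "link \<Delta> {} = \<Delta>"
  by (simp add: link_def)

lemma abstract_complex_link:
  assumes "abstract_complex \<Delta>" "F \<in> \<Delta>"
  shows "abstract_complex (link \<Delta> F)"
  unfolding abstract_complex_def
proof (intro conjI ballI allI impI)
  have "\<Union>(link \<Delta> F) \<subseteq> \<Union>\<Delta>" unfolding link_def by blast
  then show "finite (\<Union>(link \<Delta> F))"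
    using assms(1) finite_subset unfolding abstract_complex_def by blast
  show "{} \<in> link \<Delta> F"
    using assms unfolding link_def abstract_complex_def by simp
  fix H K assume H: "H \<in> link \<Delta> F" and "K \<subseteq> H"
  then have "F \<union> K \<subseteq> F \<union> H" by blast
  then have "F \<union> K \<in> \<Delta>" "K \<in> \<Delta>"
    using H \<open>K \<subseteq> H\<close> face_subset[OF assms(1)] unfolding link_def by blast+
  then show "K \<in> link \<Delta> F"
    using H \<open>K \<subseteq> H\<close> unfolding link_def by blast
qed

lemma card_link_face:
  assumes "abstract_complex \<Delta>" "F \<in> \<Delta>" "H \<in> link \<Delta> F"
  shows "card (F \<union> H) = card F + card H"
  using assms finite_face[OF assms(1)] unfolding link_def by (intro card_Un_disjoint) blast+

lemma pure_complex_link: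
  assumes pure: "pure_complex \<Delta>" and F: "F \<in> \<Delta>"
  shows "pure_complex (link \<Delta> F)"
proof -
  have \<Delta>: "abstract_complex \<Delta>" using pure by (simp add: pure_complex_def)
  have facet: "F \<union> H \<in> facets \<Delta>" if "H \<in> facets (link \<Delta> F)" for H
  proof -
    have H: "H \<in> link \<Delta> F" "\<And>K. K \<in> link \<Delta> F \<Longrightarrow> H \<subseteq> K \<Longrightarrow> K = H"
      using that by (auto simp: facets_def)
    have "K = F \<union> H" if K: "K \<in> \<Delta>" "F \<union> H \<subseteq> K" for K
    proof -
      have "F \<union> (K - F) = K" using K(2) by blast
      moreover have "K - F \<in> \<Delta>" using face_subset[OF \<Delta> K(1)] by blast
      ultimately have "K - F \<in> link \<Delta> F" using K(1) by (simp add: link_def)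
      moreover have "H \<subseteq> K - F" using K(2) H(1) unfolding link_def by blast
      ultimately have "K - F = H" by (rule H(2))
      then show ?thesis using K(2) by blast
    qed
    moreover have "F \<union> H \<in> \<Delta>" using H(1) by (simp add: link_def)
    ultimately show ?thesis unfolding facets_def by blast
  qed
  have "face_dim H = face_dim K" if "H \<in> facets (link \<Delta> F)" "K \<in> facets (link \<Delta> F)" for H K
  proof -
    have "card (F \<union> H) = card (F \<union> K)"
      using that by (intro pure_complex_card_facets[OF pure] facet)
    moreover have "H \<in> link \<Delta> F" "K \<in> link \<Delta> F"
      using that by (simp_all add: facets_def)
    ultimately show ?thesis by (simp add: card_link_face[OF \<Delta> F] face_dim_def)
  qed
  then show ?thesis
    unfolding pure_complex_def using abstract_complex_link[OF \<Delta> F] by (intro conjI ballI)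
qed

lemma del_vertex: "del \<Delta> {x} = {F \<in> \<Delta>. x \<notin> F}"
  by (simp add: del_def)

lemma abstract_complex_del:
  assumes "abstract_complex \<Delta>"
  shows "abstract_complex (del \<Delta> {x})"
  unfolding abstract_complex_def del_vertex
proof (intro conjI ballI allI impI)
  have "\<Union>{F \<in> \<Delta>. x \<notin> F} \<subseteq> \<Union>\<Delta>" by blast
  then show "finite (\<Union>{F \<in> \<Delta>. x \<notin> F})"
    using assms finite_subset unfolding abstract_complex_def by blast
  show "{} \<in> {F \<in> \<Delta>. x \<notin> F}" using assms by (simp add: abstract_complex_def)
  show "K \<in> {F \<in> \<Delta>. x \<notin> F}" if "H \<in> {F \<in> \<Delta>. x \<notin> F}" "K \<subseteq> H" for H K
    using that face_subset[OF assms] by blast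
qed

lemma vertices_del:
  assumes "abstract_complex \<Delta>"
  shows "\<Union>(del \<Delta> {x}) = \<Union>\<Delta> - {x}"
proof
  show "\<Union>\<Delta> - {x} \<subseteq> \<Union>(del \<Delta> {x})"
  proof
    fix v assume "v \<in> \<Union>\<Delta> - {x}"
    then have "{v} \<in> del \<Delta> {x}"
      using singleton_face_iff[OF assms, of v] by (auto simp: del_vertex)
    then show "v \<in> \<Union>(del \<Delta> {x})" by blast
  qed
qed (auto simp: del_vertex)

section \<open>The Cohen-Macaulay property in dimension at most one\<close>

lemma cohen_macaulay_simplex:
  fixes k :: "'k::field itself" and \<Delta> :: "'a::linorder set set"
  assumes \<Delta>: "abstract_complex \<Delta>" and V: "\<Union>\<Delta> \<in> \<Delta>"
  shows "cohen_macaulay k \<Delta>"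
  unfolding cohen_macaulay_def
proof (intro conjI ballI allI impI)
  show "pure_complex \<Delta>" using assms by (rule pure_simplex)
  fix F and j :: int assume F: "F \<in> \<Delta>" and j: "j < complex_dim (link \<Delta> F)"
  have link: "abstract_complex (link \<Delta> F)" by (rule abstract_complex_link[OF \<Delta> F])
  have "F \<union> (\<Union>\<Delta> - F) = \<Union>\<Delta>" "\<Union>\<Delta> - F \<in> \<Delta>"
    using F face_subset[OF \<Delta> V] by blast+
  then have "\<Union>\<Delta> - F \<in> link \<Delta> F" using V by (simp add: link_def)
  moreover have "\<Union>(link \<Delta> F) \<subseteq> \<Union>\<Delta> - F" unfolding link_def by blast
  ultimately have V_link: "\<Union>(link \<Delta> F) \<in> link \<Delta> F"
    by (metis Union_upper subset_antisym)
  show "trivial_group (reduced_homology k (link \<Delta> F) j)"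
  proof (cases "\<Union>(link \<Delta> F) = {}")
    case True
    obtain H where H: "H \<in> link \<Delta> F" "j < face_dim H"
      using j complex_dim_greater_iff[OF link] by blast
    then have "H = {}" using True by blast
    then have "j < -1" using H(2) by (simp add: face_dim_def)
    then show ?thesis by (rule trivial_homology_below_minus_one[OF link])
  next
    case False
    then show ?thesis by (rule trivial_homology_simplex[OF link V_link])
  qed
qed

text \<open>
  The link of a face with \<open>p\<close> vertices has faces of at most \<open>2 - p\<close> vertices.  Below its dimension,
  apart from the degrees under minus one where there are no chains, this leaves degree minus
  one, where homology vanishes as there is a vertex, and degree zero of the whole complex.
\<close>

lemma cohen_macaulay_if_connected:
  fixes k :: "'k::field itself" and \<Delta> :: "'a::linorder set set"
  assumes pure: "pure_complex \<Delta>" and dim: "\<And>F. F \<in> \<Delta> \<Longrightarrow> card F \<le> 2"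
    and conn: "\<And>F. F \<in> \<Delta> \<Longrightarrow> card F = 2 \<Longrightarrow> connected_complex \<Delta>"
  shows "cohen_macaulay k \<Delta>"
  unfolding cohen_macaulay_def
proof (intro conjI ballI allI impI)
  show "pure_complex \<Delta>" by fact
  have \<Delta>: "abstract_complex \<Delta>" using pure by (simp add: pure_complex_def)
  fix F and j :: int assume F: "F \<in> \<Delta>" and j: "j < complex_dim (link \<Delta> F)"
  have link: "abstract_complex (link \<Delta> F)" by (rule abstract_complex_link[OF \<Delta> F])
  obtain H where H: "H \<in> link \<Delta> F" "j < face_dim H"
    using j complex_dim_greater_iff[OF link] by blast
  have "F \<union> H \<in> \<Delta>" using H(1) by (simp add: link_def)
  then have card: "card F + card H \<le> 2"
    using dim card_link_face[OF \<Delta> F H(1)] by metis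
  have less: "j < int (card H) - 1" using H(2) by (simp add: face_dim_def)
  show "trivial_group (reduced_homology k (link \<Delta> F) j)"
  proof (cases "j < -1")
    case True
    then show ?thesis by (rule trivial_homology_below_minus_one[OF link])
  next
    case False
    then have "card H \<noteq> 0" using less by linarith
    then obtain v where "v \<in> H" by fastforce
    then have v: "{v} \<in> link \<Delta> F" by (intro face_subset[OF link H(1)]) simp
    show ?thesis
    proof (cases "j = -1")
      case True
      then show ?thesis using trivial_homology_minus_one[OF link v] by simp
    next
      case False
      then have "card F = 0" "card H = 2" "j = 0"
        using \<open>\<not> j < -1\<close> less card by linarith+
      then have "F = {}" using finite_face[OF \<Delta> F] by simp
      then have "H \<in> \<Delta>" using H(1) by simp
      then have "connected_complex (link \<Delta> F)"
        using conn[of H] \<open>card H = 2\<close> \<open>F = {}\<close> by simp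
      then show ?thesis
        using trivial_homology_zero_if_connected[OF link _ v] \<open>j = 0\<close> by simp
    qed
  qed
qed

lemma buchsbaum_dim_le_one:
  fixes k :: "'k::field itself" and \<Delta> :: "'a::linorder set set"
  assumes pure: "pure_complex \<Delta>" and dim: "\<And>F. F \<in> \<Delta> \<Longrightarrow> card F \<le> 2"
  shows "buchsbaum k \<Delta>"
  unfolding buchsbaum_def
proof (intro conjI allI impI)
  show "pure_complex \<Delta>" by fact
  fix x assume x: "{x} \<in> \<Delta>"
  have \<Delta>: "abstract_complex \<Delta>" using pure by (simp add: pure_complex_def)
  have "card H \<le> 1" if H: "H \<in> link \<Delta> {x}" for H
  proof -
    have "{x} \<union> H \<in> \<Delta>" using H by (simp add: link_def)
    then have "card ({x} \<union> H) \<le> 2" by (rule dim)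
    then show ?thesis by (simp only: card_link_face[OF \<Delta> x H]) simp
  qed
  note card_le_one = this
  show "cohen_macaulay k (link \<Delta> {x})"
  proof (rule cohen_macaulay_if_connected[OF pure_complex_link[OF pure x]])
    show "card H \<le> 2" if "H \<in> link \<Delta> {x}" for H
      using card_le_one[OF that] by simp
    show "connected_complex (link \<Delta> {x})" if "H \<in> link \<Delta> {x}" "card H = 2" for H
      using card_le_one[OF that(1)] that(2) by simp
  qed
qed

lemma connected_if_cohen_macaulay:
  fixes k :: "'k::field itself" and \<Delta> :: "'a::linorder set set"
  assumes cm: "cohen_macaulay k \<Delta>" and F: "F \<in> \<Delta>" "2 \<le> card F"
  shows "connected_complex \<Delta>"
proof -
  have \<Delta>: "abstract_complex \<Delta>"
    using cm by (simp add: cohen_macaulay_def pure_complex_def)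
  have "0 < complex_dim \<Delta>"
    unfolding complex_dim_greater_iff[OF \<Delta>] using F by (intro bexI[of _ F]) (simp_all add: face_dim_def)
  moreover have "{} \<in> \<Delta>" using \<Delta> by (simp add: abstract_complex_def)
  ultimately have "trivial_group (reduced_homology k \<Delta> 0)"
    using cm link_empty[of \<Delta>] unfolding cohen_macaulay_def by metis
  then show ?thesis by (rule connected_if_trivial_homology_zero[OF \<Delta>])
qed

section \<open>Connectedness of vertex decomposable and shellable complexes\<close>

text \<open>
  Complements of unions of components are again unions of components, so it suffices to look
  at those that contain a chosen vertex.
\<close>

lemma connected_complexI:
  assumes "x \<in> \<Union>\<Delta>"
    and "\<And>A. \<forall>F\<in>\<Delta>. F \<subseteq> A \<or> F \<inter> A = {} \<Longrightarrow> x \<in> A \<Longrightarrow> \<Union>\<Delta> \<subseteq> A"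
  shows "connected_complex \<Delta>"
  unfolding connected_complex_def
proof (intro allI impI)
  fix A assume A: "\<forall>F\<in>\<Delta>. F \<subseteq> A \<or> F \<inter> A = {}"
  show "\<Union>\<Delta> \<subseteq> A \<or> \<Union>\<Delta> \<inter> A = {}"
  proof (cases "x \<in> A")
    case True
    then show ?thesis using assms(2)[OF A] by simp
  next
    case False
    have "\<forall>F\<in>\<Delta>. F \<subseteq> - A \<or> F \<inter> - A = {}" using A by blast
    then have "\<Union>\<Delta> \<subseteq> - A" using False by (intro assms(2)) simp_all
    then show ?thesis by blast
  qed
qed

lemma not_separated:
  assumes "connected_complex \<Delta>" and "\<And>F. F \<in> \<Delta> \<Longrightarrow> F \<subseteq> A \<or> F \<inter> A = {}"
  shows "\<Union>\<Delta> \<subseteq> A \<or> \<Union>\<Delta> \<inter> A = {}"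
  using assms by (simp add: connected_complex_def)

lemma crossing_face:
  assumes "connected_complex \<Delta>" and "v \<in> \<Union>\<Delta>" "v \<in> A" and "\<not> \<Union>\<Delta> \<subseteq> A"
  obtains F u w where "F \<in> \<Delta>" "u \<in> F" "u \<in> A" "w \<in> F" "w \<notin> A"
proof -
  have "\<not> (\<forall>F\<in>\<Delta>. F \<subseteq> A \<or> F \<inter> A = {})"
    using not_separated[OF assms(1), of A] assms(2-4) by blast
  then show thesis using that by blast
qed

lemma pure_if_vertex_decomposable: "vertex_decomposable \<Delta> \<Longrightarrow> pure_complex \<Delta>"
  by (erule vertex_decomposable.cases) simp_all

text \<open>
  Suppose \<open>A\<close> is a union of components containing the shedding vertex \<open>x\<close>, but not everything.
  The facets outside \<open>A\<close> survive the deletion of \<open>x\<close>; by purity the deletion has facets of size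
  at least two and is connected by induction, so \<open>A\<close> contains no vertex other than \<open>x\<close>.  But
  then \<open>x\<close> would lie in no facet of size at least two.
\<close>

lemma connected_if_vertex_decomposable:
  assumes "vertex_decomposable \<Delta>" and "\<And>F. F \<in> facets \<Delta> \<Longrightarrow> 2 \<le> card F"
  shows "connected_complex \<Delta>"
  using assms
proof (induction rule: vertex_decomposable.induct)
  case (simplex \<Delta>)
  then have "\<Union>\<Delta> \<in> \<Delta>" unfolding simplex_complex_def facets_def by blast
  then show ?case unfolding connected_complex_def by (intro allI impI) (erule bspec)
next
  case (shedding \<Delta> x)
  have \<Delta>: "abstract_complex \<Delta>" using shedding.hyps(1) by (simp add: pure_complex_def)
  show ?case
  proof (rule connected_complexI)
    show "x \<in> \<Union>\<Delta>" using shedding.hyps(2) by blast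
    fix A assume A: "\<forall>F\<in>\<Delta>. F \<subseteq> A \<or> F \<inter> A = {}" and x: "x \<in> A"
    show "\<Union>\<Delta> \<subseteq> A"
    proof (rule ccontr)
      assume "\<not> \<Union>\<Delta> \<subseteq> A"
      then obtain b where b: "b \<in> \<Union>\<Delta>" "b \<notin> A" by blast
      then obtain B where "B \<in> \<Delta>" "b \<in> B" by blast
      then obtain H where H: "H \<in> facets \<Delta>" "b \<in> H"
        using face_in_facet[OF \<Delta>] by blast
      have H_A: "H \<inter> A = {}" using A H b(2) unfolding facets_def by blast
      then have H_del: "H \<in> facets (del \<Delta> {x})"
        using H(1) x unfolding facets_def del_vertex by blast
      have "connected_complex (del \<Delta> {x})"
      proof (rule shedding.IH(2))
        fix F assume "F \<in> facets (del \<Delta> {x})"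
        then have "card F = card H"
          using H_del by (rule pure_complex_card_facets[OF pure_if_vertex_decomposable[OF shedding.hyps(4)]])
        then show "2 \<le> card F" using shedding.prems[OF H(1)] by simp
      qed
      moreover have "\<forall>F\<in>del \<Delta> {x}. F \<subseteq> A \<or> F \<inter> A = {}"
        using A unfolding del_vertex by blast
      ultimately have "\<Union>\<Delta> - {x} \<subseteq> A \<or> (\<Union>\<Delta> - {x}) \<inter> A = {}"
        using not_separated[of "del \<Delta> {x}" A] vertices_del[OF \<Delta>, of x] by simp
      then have only_x: "\<Union>\<Delta> \<inter> A \<subseteq> {x}" using b x by blast
      obtain F where F: "F \<in> facets \<Delta>" "{x} \<subseteq> F"
        using face_in_facet[OF \<Delta> shedding.hyps(2)] .
      have "F \<in> \<Delta>" using F(1) by (simp add: facets_def)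
      then have "F \<subseteq> {x}" using A F(2) x only_x by blast
      then have "card F \<le> 1" by (metis card_mono card.empty finite.emptyI finite.insertI is_singletonI is_singleton_altdef)
      then show False using shedding.prems[OF F(1)] by simp
    qed
  qed
qed

text \<open>
  Each later facet of a shelling differs from an earlier one by a single vertex.  Having at
  least two vertices, it meets that earlier facet and so lies in the same component.
\<close>

lemma connected_if_shellable:
  assumes shell: "shellable \<Delta>" and card: "\<And>F. F \<in> facets \<Delta> \<Longrightarrow> 2 \<le> card F"
  shows "connected_complex \<Delta>"
proof -
  have \<Delta>: "abstract_complex \<Delta>" using shell by (simp add: shellable_def pure_complex_def)
  obtain Fs where Fs: "set Fs = facets \<Delta>"
    and shelling: "\<forall>r < length Fs. \<forall>j < r. \<exists>x \<in> Fs ! r - Fs ! j. \<exists>l < r. Fs ! r - Fs ! l = {x}"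
    using shell unfolding shellable_def by blast
  have "{} \<in> \<Delta>" using \<Delta> by (simp add: abstract_complex_def)
  then have "facets \<Delta> \<noteq> {}" using face_in_facet[OF \<Delta>] by blast
  then have "0 < length Fs" using Fs by auto
  then have facet0: "Fs ! 0 \<in> facets \<Delta>" using Fs nth_mem by blast
  then have "card (Fs ! 0) \<noteq> 0" using card[OF facet0] by simp
  then obtain x where x: "x \<in> Fs ! 0" by fastforce
  show ?thesis
  proof (rule connected_complexI)
    show "x \<in> \<Union>\<Delta>" using x facet0 unfolding facets_def by blast
    fix A assume A: "\<forall>F\<in>\<Delta>. F \<subseteq> A \<or> F \<inter> A = {}" and "x \<in> A"
    have "Fs ! r \<subseteq> A" if "r < length Fs" for r
      using that
    proof (induction r rule: less_induct)
      case (less r)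
      have facet: "Fs ! r \<in> facets \<Delta>" using Fs less.prems nth_mem by blast
      then have face: "Fs ! r \<in> \<Delta>" by (simp add: facets_def)
      show ?case
      proof (cases "r = 0")
        case True
        then show ?thesis using A face x \<open>x \<in> A\<close> by blast
      next
        case False
        then obtain y l where l: "l < r" "Fs ! r - Fs ! l = {y}"
          using shelling less.prems by blast
        have "Fs ! l \<subseteq> A" using less.IH l(1) less.prems by simp
        moreover have "Fs ! r \<noteq> {y}" using card[OF facet] by auto
        ultimately have "Fs ! r \<inter> A \<noteq> {}" using l(2) by blast
        then show ?thesis using A face by blast
      qed
    qed
    then have "F \<subseteq> A" if "F \<in> facets \<Delta>" for F
      using that Fs by (metis in_set_conv_nth)
    then show "\<Union>\<Delta> \<subseteq> A"
      using face_in_facet[OF \<Delta>] by blast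
  qed
qed

section \<open>Connected complexes of dimension one\<close>

lemma connected_vertex_in_edge:
  assumes \<Delta>: "abstract_complex \<Delta>" and conn: "connected_complex \<Delta>"
    and v: "v \<in> \<Union>\<Delta>" "\<Union>\<Delta> \<noteq> {v}"
  obtains u where "u \<noteq> v" "{u, v} \<in> \<Delta>"
proof -
  have "\<not> \<Union>\<Delta> \<subseteq> {v}" using v by blast
  then obtain F w u where F: "F \<in> \<Delta>" "w \<in> F" "w \<in> {v}" "u \<in> F" "u \<notin> {v}"
    using crossing_face[OF conn v(1) singletonI] by metis
  then have "{u, v} \<in> \<Delta>" using face_subset[OF \<Delta> F(1)] by simp
  then show thesis using F(5) that by simp
qed

text \<open>
  A maximal nonempty proper vertex set inducing a connected complex is left by some edge, and adding the
  other end of that edge keeps the induced complex connected.  By maximality that end is the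
  only vertex outside, so it can be deleted.
\<close>

lemma connected_delete_vertex:
  assumes \<Delta>: "abstract_complex \<Delta>" and conn: "connected_complex \<Delta>"
    and V: "r \<in> \<Union>\<Delta>" "\<Union>\<Delta> \<noteq> {r}"
  obtains x where "x \<in> \<Union>\<Delta>" "connected_complex (del \<Delta> {x})"
proof -
  define R where "R A = {F \<in> \<Delta>. F \<subseteq> A}" for A
  define \<A> where "\<A> = {A. A \<subset> \<Union>\<Delta> \<and> A \<noteq> {} \<and> connected_complex (R A)}"
  have "\<A> \<subseteq> Pow (\<Union>\<Delta>)" unfolding \<A>_def by blast
  then have "finite \<A>"
    using \<Delta> by (auto simp: abstract_complex_def intro: finite_subset)
  moreover have "connected_complex (R {r})"
    unfolding connected_complex_def R_def by blast
  then have "{r} \<in> \<A>" using V unfolding \<A>_def by blast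
  ultimately obtain A where A: "A \<in> \<A>" and max: "\<And>B. B \<in> \<A> \<Longrightarrow> A \<subseteq> B \<Longrightarrow> A = B"
    using finite_has_maximal2 by metis
  have A': "A \<subset> \<Union>\<Delta>" "A \<noteq> {}" "connected_complex (R A)" using A by (simp_all add: \<A>_def)
  then obtain v where "v \<in> \<Union>\<Delta>" "v \<in> A" "\<not> \<Union>\<Delta> \<subseteq> A" by blast
  then obtain F u x where F: "F \<in> \<Delta>" and ux: "u \<in> F" "u \<in> A" "x \<in> F" "x \<notin> A"
    using crossing_face[OF conn] by metis
  then have edge: "{u, x} \<in> \<Delta>" using face_subset[OF \<Delta> F] by simp
  have vertices: "\<Union>(R B) = B" if "B \<subseteq> \<Union>\<Delta>" for B
  proof
    show "B \<subseteq> \<Union>(R B)"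
    proof
      fix v assume v: "v \<in> B"
      then have "{v} \<in> R B"
        using that singleton_face_iff[OF \<Delta>, of v] unfolding R_def by blast
      then show "v \<in> \<Union>(R B)" by blast
    qed
  qed (auto simp: R_def)
  have x: "x \<in> \<Union>\<Delta>" using ux F by blast
  have "connected_complex (R (insert x A))"
  proof (rule connected_complexI)
    show "u \<in> \<Union>(R (insert x A))" using ux x A'(1) by (subst vertices) auto
    fix B assume B: "\<forall>F\<in>R (insert x A). F \<subseteq> B \<or> F \<inter> B = {}" and u: "u \<in> B"
    have "R A \<subseteq> R (insert x A)" unfolding R_def by blast
    then have "\<Union>(R A) \<subseteq> B \<or> \<Union>(R A) \<inter> B = {}"
      using B by (intro not_separated[OF A'(3)]) blast
    then have "A \<subseteq> B \<or> A \<inter> B = {}" using vertices[of A] A'(1) by simp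
    then have "A \<subseteq> B" using ux(2) u by blast
    moreover have "x \<in> B"
    proof -
      have "{u, x} \<in> R (insert x A)" using edge ux by (simp add: R_def)
      with B have "{u, x} \<subseteq> B \<or> {u, x} \<inter> B = {}" by (rule bspec)
      then show ?thesis using u by simp
    qed
    moreover have "\<Union>(R (insert x A)) = insert x A" using x A'(1) by (intro vertices) blast
    ultimately show "\<Union>(R (insert x A)) \<subseteq> B" by simp
  qed
  then have "\<not> insert x A \<subset> \<Union>\<Delta>"
    using max[of "insert x A"] ux(4) unfolding \<A>_def by blast
  then have V_eq: "\<Union>\<Delta> = insert x A" using A'(1) x by blast
  have "F \<subseteq> A \<longleftrightarrow> x \<notin> F" if "F \<in> \<Delta>" for F
  proof -
    have "F \<subseteq> insert x A" unfolding V_eq[symmetric] using that by (rule Union_upper)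
    then show ?thesis using ux(4) by blast
  qed
  then have "R A = del \<Delta> {x}" unfolding R_def del_vertex by (intro Collect_cong conj_cong refl)
  then show thesis using that[OF x] A'(3) by simp
qed

lemma vertex_decomposable_simplex:
  assumes "abstract_complex \<Delta>" "\<Union>\<Delta> \<in> \<Delta>"
  shows "vertex_decomposable \<Delta>"
  using pure_simplex[OF assms] by (intro vertex_decomposable.simplex) (simp_all add: simplex_complex_def)

lemma shellable_simplex:
  assumes "abstract_complex \<Delta>" "\<Union>\<Delta> \<in> \<Delta>"
  shows "shellable \<Delta>"
  unfolding shellable_def using pure_simplex[OF assms] by (intro conjI exI[of _ "[\<Union>\<Delta>]"]) simp_all

lemma vertices_psubset_del:
  assumes "abstract_complex \<Delta>" "x \<in> \<Union>\<Delta>"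
  shows "card (\<Union>(del \<Delta> {x})) < card (\<Union>\<Delta>)"
  unfolding vertices_del[OF assms(1)]
  using assms by (intro psubset_card_mono) (auto simp: abstract_complex_def)

lemma vertex_decomposable_points:
  assumes "abstract_complex \<Delta>" and "\<And>F. F \<in> \<Delta> \<Longrightarrow> card F \<le> 1"
  shows "vertex_decomposable \<Delta>"
  using assms
proof (induction "card (\<Union>\<Delta>)" arbitrary: \<Delta> rule: less_induct)
  case (less \<Delta>)
  note \<Delta> = less.prems(1)
  have empty: "{} \<in> \<Delta>" using \<Delta> by (simp add: abstract_complex_def)
  show ?case
  proof (cases "\<Union>\<Delta> \<in> \<Delta>")
    case True
    then show ?thesis by (rule vertex_decomposable_simplex[OF \<Delta>])
  next
    case False
    then have "\<Union>\<Delta> \<noteq> {}" using empty by metis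
    then obtain x where x: "x \<in> \<Union>\<Delta>" by blast
    then have face_x: "{x} \<in> \<Delta>" using singleton_face_iff[OF \<Delta>] by blast
    show ?thesis
    proof (rule vertex_decomposable.shedding[OF _ face_x])
      show "pure_complex \<Delta>"
      proof (rule pure_complexI(1)[OF \<Delta>])
        fix F assume F: "F \<in> \<Delta>"
        show "\<exists>H\<in>\<Delta>. F \<subseteq> H \<and> card H = 1"
        proof (cases "F = {}")
          case True
          then show ?thesis using face_x by (intro bexI[of _ "{x}"]) simp_all
        next
          case False
          then have "card F \<noteq> 0" using finite_face[OF \<Delta> F] by simp
          then have "card F = 1" using less.prems(2)[OF F] by linarith
          then show ?thesis using F by blast
        qed
      qed
      have "H = {}" if H: "H \<in> link \<Delta> {x}" for H
      proof -
        have "{x} \<union> H \<in> \<Delta>" using H by (simp add: link_def)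
        then have "card ({x} \<union> H) \<le> 1" by (rule less.prems(2))
        then have "card H = 0" by (simp only: card_link_face[OF \<Delta> face_x H]) simp
        moreover have "finite H" using H finite_face[OF \<Delta>] by (simp add: link_def)
        ultimately show ?thesis by simp
      qed
      moreover have "{} \<in> link \<Delta> {x}" using empty face_x by (simp add: link_def)
      ultimately have "link \<Delta> {x} = {{}}" by blast
      then show "vertex_decomposable (link \<Delta> {x})"
        by (intro vertex_decomposable_simplex) (simp_all add: abstract_complex_def)
      show "vertex_decomposable (del \<Delta> {x})"
        using vertices_psubset_del[OF \<Delta> x] abstract_complex_del[OF \<Delta>]
      proof (rule less.hyps)
        show "card F \<le> 1" if "F \<in> del \<Delta> {x}" for F
          using that less.prems(2) by (simp add: del_vertex)
      qed
    qed
  qed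
qed

text \<open>
  A vertex whose deletion leaves the complex connected is a shedding vertex: its link consists of
  isolated points.  Purity comes for free, since in a connected complex with at least two vertices
  every vertex lies on an edge.
\<close>

lemma vertex_decomposable_if_connected:
  assumes "abstract_complex \<Delta>" and "connected_complex \<Delta>" and "\<And>F. F \<in> \<Delta> \<Longrightarrow> card F \<le> 2"
  shows "vertex_decomposable \<Delta>"
  using assms
proof (induction "card (\<Union>\<Delta>)" arbitrary: \<Delta> rule: less_induct)
  case (less \<Delta>)
  note \<Delta> = less.prems(1) and conn = less.prems(2) and card = less.prems(3)
  have empty: "{} \<in> \<Delta>" using \<Delta> by (simp add: abstract_complex_def)
  show ?case
  proof (cases "\<Union>\<Delta> = {} \<or> (\<exists>r. \<Union>\<Delta> = {r})")
    case True
    then have "\<Union>\<Delta> \<in> \<Delta>"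
    proof
      assume "\<exists>r. \<Union>\<Delta> = {r}"
      then obtain r where r: "\<Union>\<Delta> = {r}" by blast
      have "{r} \<in> \<Delta>" unfolding singleton_face_iff[OF \<Delta>] r by simp
      then show ?thesis by (simp only: r)
    qed (use empty in \<open>simp only:\<close>)
    then show ?thesis by (rule vertex_decomposable_simplex[OF \<Delta>])
  next
    case False
    then obtain r where r: "r \<in> \<Union>\<Delta>" and not_point: "\<And>v. \<Union>\<Delta> \<noteq> {v}" by blast
    obtain x where x: "x \<in> \<Union>\<Delta>" and conn_del: "connected_complex (del \<Delta> {x})"
      using connected_delete_vertex[OF \<Delta> conn r not_point] .
    have face_x: "{x} \<in> \<Delta>" using x singleton_face_iff[OF \<Delta>] by blast
    have edge: "\<exists>H\<in>\<Delta>. v \<in> H \<and> card H = 2" if v: "v \<in> \<Union>\<Delta>" for v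
    proof -
      obtain u where "u \<noteq> v" "{u, v} \<in> \<Delta>"
        using connected_vertex_in_edge[OF \<Delta> conn v not_point] .
      then show ?thesis by (intro bexI[of _ "{u, v}"]) simp_all
    qed
    show ?thesis
    proof (rule vertex_decomposable.shedding[OF _ face_x])
      show "pure_complex \<Delta>"
      proof (rule pure_complexI(1)[OF \<Delta>])
        fix F assume F: "F \<in> \<Delta>"
        then have "card F \<le> 2" by (rule card)
        then consider "F = {}" | v where "F = {v}" | "card F = 2"
          using finite_face[OF \<Delta> F] by (metis card_0_eq card_1_singletonE le_Suc_eq le_zero_eq numeral_2_eq_2 One_nat_def)
        then show "\<exists>H\<in>\<Delta>. F \<subseteq> H \<and> card H = 2"
        proof cases
          case 1
          then show ?thesis using edge[OF r] by blast
        next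
          case (2 v)
          then show ?thesis using edge[of v] F by blast
        next
          case 3
          then show ?thesis using F by blast
        qed
      qed
      show "vertex_decomposable (link \<Delta> {x})"
      proof (rule vertex_decomposable_points[OF abstract_complex_link[OF \<Delta> face_x]])
        fix H assume H: "H \<in> link \<Delta> {x}"
        then have "{x} \<union> H \<in> \<Delta>" by (simp add: link_def)
        then have "card ({x} \<union> H) \<le> 2" by (rule card)
        then show "card H \<le> 1" by (simp only: card_link_face[OF \<Delta> face_x H]) simp
      qed
      show "vertex_decomposable (del \<Delta> {x})"
        using vertices_psubset_del[OF \<Delta> x] abstract_complex_del[OF \<Delta>] conn_del
      proof (rule less.hyps)
        show "card F \<le> 2" if "F \<in> del \<Delta> {x}" for F
          using that card by (simp add: del_vertex)
      qed
    qed
  qed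
qed

text \<open>
  For edges, the shelling condition only asks that each edge after the first meets an earlier
  one.  Such lists can be prolonged until they contain all edges: an edge meeting the
  part covered so far must exist, for otherwise that part would be a union of components.
\<close>

lemma shellable_if_connected:
  assumes pure: "pure_complex \<Delta>" and card: "\<And>F. F \<in> facets \<Delta> \<Longrightarrow> card F = 2"
    and conn: "connected_complex \<Delta>"
  shows "shellable \<Delta>"
proof -
  have \<Delta>: "abstract_complex \<Delta>" using pure by (simp add: pure_complex_def)
  have fin: "finite (facets \<Delta>)" using finite_complex[OF \<Delta>] by (simp add: facets_def)
  have "\<exists>Fs. length Fs = m \<and> distinct Fs \<and> set Fs \<subseteq> facets \<Delta> \<and>
      (\<forall>r < length Fs. 0 < r \<longrightarrow> (\<exists>l < r. Fs ! l \<inter> Fs ! r \<noteq> {}))"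
    if "m \<le> card (facets \<Delta>)" for m
    using that
  proof (induction m)
    case 0
    show ?case by (rule exI[of _ "[]"]) simp
  next
    case (Suc m)
    then obtain Fs where len: "length Fs = m" and Fs: "distinct Fs" "set Fs \<subseteq> facets \<Delta>"
      and meets: "\<forall>r < length Fs. 0 < r \<longrightarrow> (\<exists>l < r. Fs ! l \<inter> Fs ! r \<noteq> {})"
      by auto
    have "set Fs \<noteq> facets \<Delta>"
      using Suc.prems len distinct_card[OF Fs(1)] by auto
    then obtain F0 where F0: "F0 \<in> facets \<Delta>" "F0 \<notin> set Fs" using Fs(2) by blast
    have "\<exists>F\<in>facets \<Delta>. F \<notin> set Fs \<and> (m = 0 \<or> F \<inter> \<Union>(set Fs) \<noteq> {})"
    proof (rule ccontr)
      assume none: "\<not> ?thesis"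
      have extends: "m \<noteq> 0 \<and> F \<inter> \<Union>(set Fs) = {}" if F: "F \<in> facets \<Delta>" "F \<notin> set Fs" for F
      proof (rule ccontr)
        assume "\<not> ?thesis"
        then have "F \<notin> set Fs \<and> (m = 0 \<or> F \<inter> \<Union>(set Fs) \<noteq> {})" using F(2) by blast
        with F(1) have "\<exists>F\<in>facets \<Delta>. F \<notin> set Fs \<and> (m = 0 \<or> F \<inter> \<Union>(set Fs) \<noteq> {})"
          by (rule rev_bexI)
        with none show False by contradiction
      qed
      then have m: "m \<noteq> 0" using F0 by simp
      have disj: "F \<inter> \<Union>(set Fs) = {}" if "F \<in> facets \<Delta>" "F \<notin> set Fs" for F
        using extends[OF that] by simp
      let ?A = "\<Union>(set Fs)"
      have "F \<subseteq> ?A \<or> F \<inter> ?A = {}" if "F \<in> \<Delta>" for F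
      proof -
        obtain H where "H \<in> facets \<Delta>" "F \<subseteq> H" using face_in_facet[OF \<Delta> \<open>F \<in> \<Delta>\<close>] .
        then show ?thesis using disj[of H] by (cases "H \<in> set Fs") blast+
      qed
      then have cases: "\<Union>\<Delta> \<subseteq> ?A \<or> \<Union>\<Delta> \<inter> ?A = {}" by (rule not_separated[OF conn])
      have nonempty: "F \<noteq> {}" "F \<subseteq> \<Union>\<Delta>" if "F \<in> facets \<Delta>" for F
        using card[OF that] that by (auto simp: facets_def)
      have "hd Fs \<in> set Fs" using m len by (cases Fs) simp_all
      then have "\<Union>\<Delta> \<inter> ?A \<noteq> {}" using Fs(2) nonempty by blast
      then have "F0 \<subseteq> ?A" using cases nonempty(2)[OF F0(1)] by blast
      then show False using disj[OF F0] nonempty(1)[OF F0(1)] by blast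
    qed
    then obtain F where F: "F \<in> facets \<Delta>" "F \<notin> set Fs" "m = 0 \<or> F \<inter> \<Union>(set Fs) \<noteq> {}"
      by blast
    have "\<exists>l < r. (Fs @ [F]) ! l \<inter> (Fs @ [F]) ! r \<noteq> {}" if r: "r < length (Fs @ [F])" "0 < r" for r
    proof (cases "r < m")
      case True
      then obtain l where "l < r" "Fs ! l \<inter> Fs ! r \<noteq> {}" using meets r(2) len by blast
      then show ?thesis using True len by (intro exI[of _ l]) (simp add: nth_append)
    next
      case False
      then have "r = m" using r(1) len by simp
      then have "F \<inter> \<Union>(set Fs) \<noteq> {}" using F(3) r(2) by blast
      then obtain H where "H \<in> set Fs" "H \<inter> F \<noteq> {}" by blast
      then obtain l where "l < m" "Fs ! l \<inter> F \<noteq> {}" using len by (metis in_set_conv_nth)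
      then show ?thesis using \<open>r = m\<close> len by (intro exI[of _ l]) (simp add: nth_append)
    qed
    then show ?case
      using len Fs F by (intro exI[of _ "Fs @ [F]"]) simp
  qed
  then obtain Fs where len: "length Fs = card (facets \<Delta>)" and Fs: "distinct Fs" "set Fs \<subseteq> facets \<Delta>"
    and meets: "\<forall>r < length Fs. 0 < r \<longrightarrow> (\<exists>l < r. Fs ! l \<inter> Fs ! r \<noteq> {})"
    by blast
  have all: "set Fs = facets \<Delta>"
    using card_subset_eq[OF fin Fs(2)] len distinct_card[OF Fs(1)] by simp
  have diff: "\<exists>x. P - Q = {x}" if "card P = 2" "card Q = 2" "P \<noteq> Q" "Q \<inter> P \<noteq> {}" for P Q :: "'a set"
  proof -
    obtain a b c d where "P = {a, b}" "a \<noteq> b" "Q = {c, d}" "c \<noteq> d"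
      using \<open>card P = 2\<close> \<open>card Q = 2\<close> unfolding card_2_iff by blast
    then have "P - Q = {a} \<or> P - Q = {b}" using that(3,4) by auto
    then show ?thesis by blast
  qed
  have "\<exists>x \<in> Fs ! r - Fs ! j. \<exists>l < r. Fs ! r - Fs ! l = {x}" if r: "r < length Fs" and j: "j < r" for r j
  proof -
    have two: "card (Fs ! l) = 2" if "l < length Fs" for l
      using that card all nth_mem by blast
    have ne: "Fs ! r \<noteq> Fs ! l" if "l < r" for l
      using that r Fs(1) by (simp add: nth_eq_iff_index_eq)
    show ?thesis
    proof (cases "Fs ! j \<inter> Fs ! r = {}")
      case True
      obtain l where l: "l < r" "Fs ! l \<inter> Fs ! r \<noteq> {}" using meets r j by (metis gr_implies_not0 neq0_conv)
      then obtain x where "Fs ! r - Fs ! l = {x}"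
        using diff[of "Fs ! r" "Fs ! l"] two[of r] two[of l] ne[of l] r by auto
      then show ?thesis using l(1) True by blast
    next
      case False
      then obtain x where "Fs ! r - Fs ! j = {x}"
        using diff[of "Fs ! r" "Fs ! j"] two[of r] two[of j] ne[of j] r j by auto
      then show ?thesis using j by blast
    qed
  qed
  then show ?thesis
    unfolding shellable_def using pure Fs(1) all by blast
qed

section \<open>The independence complex of the circulant graph\<close>

text \<open>
  The clique complex of the graph on \<open>{0..<n}\<close> in which \<open>v\<close> is joined to \<open>v + i\<close> modulo \<open>n\<close>.
  For \<open>a < b < n\<close> the difference \<open>b - a\<close> is congruent to \<open>i\<close> or to \<open>- i\<close> modulo \<open>n\<close> if and only if it
  equals \<open>i\<close> or \<open>n - i\<close>; comparing only \<open>a < b\<close> keeps faces accessible to linear arithmetic.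
\<close>

definition jump_complex :: "nat \<Rightarrow> nat \<Rightarrow> nat set set" where
  "jump_complex n i =
    {W. W \<subseteq> {0..<n} \<and> (\<forall>a\<in>W. \<forall>b\<in>W. a < b \<longrightarrow> b = a + i \<or> b + i = a + n)}"

text \<open>
  One of \<open>b - a\<close> and \<open>n - (b - a)\<close> is at most \<open>n div 2\<close>, and the vertices are adjacent unless that
  one is \<open>i\<close>.
\<close>

lemma circulant_nonadjacent_iff:
  fixes n i a b :: nat
  assumes i: "1 \<le> i" "i \<le> n div 2" and ab: "a < b" "b < n"
  shows "(a, b) \<notin> parcs (circulant n ({1..n div 2} - {i})) \<longleftrightarrow> b = a + i \<or> b + i = a + n"
    and "(b, a) \<notin> parcs (circulant n ({1..n div 2} - {i})) \<longleftrightarrow> b = a + i \<or> b + i = a + n"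
proof -
  have d: "nat \<bar>int a - int b\<bar> = b - a" "nat \<bar>int b - int a\<bar> = b - a" using ab by simp_all
  have parcs: "(a, b) \<in> parcs (circulant n T) \<longleftrightarrow> b - a \<in> T \<or> n - (b - a) \<in> T"
    "(b, a) \<in> parcs (circulant n T) \<longleftrightarrow> b - a \<in> T \<or> n - (b - a) \<in> T" for T
    unfolding circulant_def Let_def pair_pre_digraph.select_convs mem_Collect_eq prod.case d
    using ab by auto
  define e where "e = n - (b - a)"
  have pos: "1 \<le> b - a" "1 \<le> e" "(b - a) + e = n" using ab by (simp_all add: e_def)
  have half: "2 * (n div 2) \<le> (b - a) + e" "(b - a) + e \<le> 2 * (n div 2) + 1" using pos(3) by simp_all
  consider "b - a \<le> n div 2" "e \<le> n div 2" | "b - a \<le> n div 2" "n div 2 < e" | "n div 2 < b - a" "e \<le> n div 2"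
    using half by linarith
  then have "(b - a \<le> n div 2 \<longrightarrow> b - a = i) \<and> (e \<le> n div 2 \<longrightarrow> e = i) \<longleftrightarrow> b - a = i \<or> e = i"
  proof cases
    case 1
    then have "b - a = n div 2" "e = n div 2" using half by linarith+
    then show ?thesis by simp
  qed (use i in simp_all)
  moreover have "b - a = i \<longleftrightarrow> b = a + i" "e = i \<longleftrightarrow> b + i = a + n"
    using ab by (auto simp: e_def)
  ultimately have "(b - a \<notin> {1..n div 2} - {i} \<and> n - (b - a) \<notin> {1..n div 2} - {i})
      \<longleftrightarrow> b = a + i \<or> b + i = a + n"
    using pos unfolding e_def[symmetric] by simp
  then show "(a, b) \<notin> parcs (circulant n ({1..n div 2} - {i})) \<longleftrightarrow> b = a + i \<or> b + i = a + n"
    and "(b, a) \<notin> parcs (circulant n ({1..n div 2} - {i})) \<longleftrightarrow> b = a + i \<or> b + i = a + n"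
    by (simp_all only: parcs de_Morgan_disj)
qed

lemma ind_complex_circulant:
  assumes "1 \<le> i" "i \<le> n div 2"
  shows "ind_complex (circulant n ({1..n div 2} - {i})) = jump_complex n i"
proof -
  let ?G = "circulant n ({1..n div 2} - {i})"
  have verts: "pverts ?G = {0..<n}" by (simp add: circulant_def)
  have loops: "(a, a) \<notin> parcs ?G" for a by (simp add: circulant_def)
  have "(\<forall>a\<in>W. \<forall>b\<in>W. (a, b) \<notin> parcs ?G) \<longleftrightarrow>
      (\<forall>a\<in>W. \<forall>b\<in>W. a < b \<longrightarrow> b = a + i \<or> b + i = a + n)" if W: "W \<subseteq> {0..<n}" for W
  proof
    assume *: "\<forall>a\<in>W. \<forall>b\<in>W. (a, b) \<notin> parcs ?G"
    show "\<forall>a\<in>W. \<forall>b\<in>W. a < b \<longrightarrow> b = a + i \<or> b + i = a + n"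
    proof (intro ballI impI)
      fix a b assume "a \<in> W" "b \<in> W" "a < b"
      then show "b = a + i \<or> b + i = a + n"
        using * W circulant_nonadjacent_iff(1)[OF assms, of a b] by auto
    qed
  next
    assume *: "\<forall>a\<in>W. \<forall>b\<in>W. a < b \<longrightarrow> b = a + i \<or> b + i = a + n"
    show "\<forall>a\<in>W. \<forall>b\<in>W. (a, b) \<notin> parcs ?G"
    proof (intro ballI)
      fix a b assume ab: "a \<in> W" "b \<in> W"
      then have "a < n" "b < n" using W by auto
      then show "(a, b) \<notin> parcs ?G"
        using * ab loops circulant_nonadjacent_iff(1)[OF assms, of a b]
          circulant_nonadjacent_iff(2)[OF assms, of b a]
        by (cases a b rule: linorder_cases) simp_all
    qed
  qed
  then show ?thesis
    unfolding ind_complex_def jump_complex_def verts by (intro Collect_cong conj_cong refl)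
qed

lemma jump_complex_face:
  assumes "W \<in> jump_complex n i" "a \<in> W" "b \<in> W" "a < b"
  shows "b = a + i \<or> b + i = a + n"
  using assms by (simp add: jump_complex_def)

lemma jump_complex_bound: "W \<in> jump_complex n i \<Longrightarrow> a \<in> W \<Longrightarrow> a < n"
  unfolding jump_complex_def by fastforce

lemma abstract_complex_jump_complex: "abstract_complex (jump_complex n i)"
  unfolding abstract_complex_def
proof (intro conjI ballI allI impI)
  have "\<Union>(jump_complex n i) \<subseteq> {0..<n}" unfolding jump_complex_def by blast
  then show "finite (\<Union>(jump_complex n i))" by (rule finite_subset) simp
  show "{} \<in> jump_complex n i" by (simp add: jump_complex_def)
  show "K \<in> jump_complex n i" if "H \<in> jump_complex n i" "K \<subseteq> H" for H K
    using that unfolding jump_complex_def by blast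
qed

lemma jump_complex_vertex: "v < n \<Longrightarrow> {v} \<in> jump_complex n i"
  by (simp add: jump_complex_def)

lemma vertices_jump_complex: "\<Union>(jump_complex n i) = {0..<n}"
proof
  show "\<Union>(jump_complex n i) \<subseteq> {0..<n}" unfolding jump_complex_def by blast
  show "{0..<n} \<subseteq> \<Union>(jump_complex n i)"
  proof
    fix v assume "v \<in> {0..<n}"
    then have "{v} \<in> jump_complex n i" by (intro jump_complex_vertex) simp
    then show "v \<in> \<Union>(jump_complex n i)" by blast
  qed
qed

lemma jump_complex_edge:
  assumes "1 \<le> i" "2 * i \<le> n" "v < n"
  shows "{v, (v + i) mod n} \<in> jump_complex n i" "(v + i) mod n \<noteq> v"
proof -
  have "(v + i) mod n = (if v + i < n then v + i else v + i - n)"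
    using assms by (simp add: mod_if)
  then show "{v, (v + i) mod n} \<in> jump_complex n i" "(v + i) mod n \<noteq> v"
    using assms by (auto simp: jump_complex_def)
qed

text \<open>
  All jumps are multiples of \<open>gcd i n\<close>, so the multiples of it form a union of components.
  Conversely, if the gcd is one, some multiple of \<open>i\<close> is congruent to \<open>w\<close> for every vertex \<open>w\<close>, so
  repeated jumps lead from \<open>0\<close> to \<open>w\<close>.
\<close>

lemma jump_complex_connected_iff:
  assumes i: "1 \<le> i" "2 * i \<le> n"
  shows "connected_complex (jump_complex n i) \<longleftrightarrow> gcd i n = 1"
proof
  assume conn: "connected_complex (jump_complex n i)"
  let ?A = "{v. gcd i n dvd v}"
  have "W \<subseteq> ?A \<or> W \<inter> ?A = {}" if W: "W \<in> jump_complex n i" for W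
  proof -
    have "gcd i n dvd a \<longleftrightarrow> gcd i n dvd b" if "a \<in> W" "b \<in> W" "a < b" for a b
      using jump_complex_face[OF W that]
    proof
      assume "b + i = a + n"
      then have "gcd i n dvd b + i \<longleftrightarrow> gcd i n dvd a + n" by simp
      then show ?thesis by (simp add: dvd_add_left_iff)
    qed (simp add: dvd_add_left_iff)
    then have "gcd i n dvd a \<longleftrightarrow> gcd i n dvd b" if "a \<in> W" "b \<in> W" for a b
      using that by (cases a b rule: linorder_cases) blast+
    then show ?thesis by blast
  qed
  then have "{0..<n} \<subseteq> ?A \<or> {0..<n} \<inter> ?A = {}"
    using not_separated[OF conn, of ?A] unfolding vertices_jump_complex by simp
  moreover have "0 \<in> {0..<n} \<inter> ?A" using i by simp
  ultimately have "{0..<n} \<subseteq> ?A" by blast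
  moreover have "1 \<in> {0..<n}" using i by simp
  ultimately have "1 \<in> ?A" by (rule subsetD)
  then show "gcd i n = 1" by simp
next
  assume gcd: "gcd i n = 1"
  show "connected_complex (jump_complex n i)"
  proof (rule connected_complexI)
    show "0 \<in> \<Union>(jump_complex n i)" using i by (simp add: vertices_jump_complex)
    fix A assume A: "\<forall>F\<in>jump_complex n i. F \<subseteq> A \<or> F \<inter> A = {}" and "0 \<in> A"
    have multiple: "(k * i) mod n \<in> A" for k
    proof (induction k)
      case 0
      then show ?case using \<open>0 \<in> A\<close> by simp
    next
      case (Suc k)
      have "(k * i) mod n < n" using i by simp
      from jump_complex_edge(1)[OF i this]
      have "{(k * i) mod n, ((k * i) mod n + i) mod n} \<in> jump_complex n i" .
      with A have "{(k * i) mod n, ((k * i) mod n + i) mod n} \<subseteq> A \<or>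
          {(k * i) mod n, ((k * i) mod n + i) mod n} \<inter> A = {}"
        by (rule bspec)
      then have "((k * i) mod n + i) mod n \<in> A" using Suc.IH by simp
      then show ?case by (simp add: mod_simps add.commute)
    qed
    have "i \<noteq> 0" using i by simp
    then obtain x y where xy: "i * x = n * y + 1"
      using bezout_nat[of i n] unfolding gcd by blast
    have "(w * x) * i = w + n * (w * y)" for w
    proof -
      have "(w * x) * i = w * (i * x)" by (simp add: mult_ac)
      also have "\<dots> = w + n * (w * y)" unfolding xy by (simp add: algebra_simps)
      finally show ?thesis .
    qed
    then have "((w * x) * i) mod n = w" if "w < n" for w
      using that by simp
    then have "w \<in> A" if "w < n" for w
      using multiple[of "w * x"] that by simp
    then show "\<Union>(jump_complex n i) \<subseteq> A" unfolding vertices_jump_complex by auto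
  qed
qed

text \<open>
  For \<open>a < b < c\<close> in a face, \<open>c - a\<close> is the sum of the two smaller differences.  With all three
  differences in \<open>{i, n - i}\<close> this is only possible as \<open>n - i = i + i\<close>.
\<close>

lemma jump_complex_dim_le_one:
  assumes i: "1 \<le> i" "2 * i \<le> n" "n \<noteq> 3 * i" and W: "W \<in> jump_complex n i"
  shows "card W \<le> 2"
proof (rule ccontr)
  assume "\<not> card W \<le> 2"
  then have card: "2 < card W" by simp
  then have fin: "finite W" using card_gt_0_iff by fastforce
  have ne: "W \<noteq> {}" using card by auto
  have "\<not> W \<subseteq> {Min W, Max W}"
  proof
    assume "W \<subseteq> {Min W, Max W}"
    then have "card W \<le> card {Min W, Max W}" by (intro card_mono) simp_all
    also have "\<dots> \<le> 2" by (simp add: card_insert_if)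
    finally show False using card by simp
  qed
  then obtain b where b: "b \<in> W" "b \<noteq> Min W" "b \<noteq> Max W" by blast
  define a c where "a = Min W" and "c = Max W"
  have ac: "a \<in> W" "c \<in> W" unfolding a_def c_def using fin ne by simp_all
  have "a < b" "b < c"
    using b Min_le[OF fin b(1)] Max_ge[OF fin b(1)] unfolding a_def c_def order_less_le by simp_all
  moreover have "c < n" using jump_complex_bound[OF W ac(2)] .
  moreover have "b = a + i \<or> b + i = a + n" "c = b + i \<or> c + i = b + n" "c = a + i \<or> c + i = a + n"
    using jump_complex_face[OF W] ac b(1) calculation by auto
  ultimately show False using i by linarith
qed

lemma jump_complex_pure_dim_one:
  assumes i: "1 \<le> i" "2 * i \<le> n" "n \<noteq> 3 * i"
  shows "pure_complex (jump_complex n i)" "\<forall>F\<in>facets (jump_complex n i). card F = 2"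
proof -
  have "\<exists>H\<in>jump_complex n i. F \<subseteq> H \<and> card H = 2" if F: "F \<in> jump_complex n i" for F
  proof -
    have edge: "\<exists>H\<in>jump_complex n i. {v} \<subseteq> H \<and> card H = 2" if "v < n" for v
      using jump_complex_edge[OF i(1,2) that] by (intro bexI[of _ "{v, (v + i) mod n}"]) auto
    have "card F \<le> 2" by (rule jump_complex_dim_le_one[OF i F])
    then consider "card F = 0" | "card F = 1" | "card F = 2" by linarith
    then show ?thesis
    proof cases
      case 1
      then have "F = {}" using finite_face[OF abstract_complex_jump_complex F] by simp
      then show ?thesis using edge[of 0] i by auto
    next
      case 2
      then obtain v where "F = {v}" by (auto simp: card_1_singleton_iff)
      then show ?thesis using edge[of v] jump_complex_bound[OF F] by simp
    next
      case 3
      then show ?thesis using F by blast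
    qed
  qed
  note in_face_of_full_size = this
  show "pure_complex (jump_complex n i)"
    by (rule pure_complexI(1)[OF abstract_complex_jump_complex in_face_of_full_size])
  show "\<forall>F\<in>facets (jump_complex n i). card F = 2"
    by (rule pure_complexI(2)[OF abstract_complex_jump_complex in_face_of_full_size])
qed

text \<open>
  If \<open>n = 3 * i\<close>, two vertices are joined if and only if they are congruent modulo \<open>i\<close>, so the facets
  are the residue classes.
\<close>

lemma jump_complex_triangle:
  assumes "r < i"
  shows "{r, r + i, r + 2 * i} \<in> jump_complex (3 * i) i" "card {r, r + i, r + 2 * i} = 3"
  using assms by (auto simp: jump_complex_def)

lemma jump_complex_face_in_triangle:
  assumes W: "W \<in> jump_complex (3 * i) i" and a: "a \<in> W"
  shows "W \<subseteq> {a mod i, a mod i + i, a mod i + 2 * i}"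
proof
  have i: "0 < i" using jump_complex_bound[OF assms] by simp
  fix b assume b: "b \<in> W"
  have "b mod i = a mod i"
  proof (cases a b rule: linorder_cases)
    case less
    then have "b = a + i \<or> b = a + 2 * i" using jump_complex_face[OF W a b] by auto
    then show ?thesis by auto
  next
    case greater
    then have "a = b + i \<or> a = b + 2 * i" using jump_complex_face[OF W b a] by auto
    then show ?thesis by auto
  qed simp
  moreover have "b div i < 3" using jump_complex_bound[OF W b] i by (simp add: less_mult_imp_div_less)
  then have "b div i = 0 \<or> b div i = 1 \<or> b div i = 2" by linarith
  moreover have "b = b mod i + b div i * i" by simp
  ultimately show "b \<in> {a mod i, a mod i + i, a mod i + 2 * i}"
    by (metis add.right_neutral insert_iff mult_0 mult_1)
qed

lemma jump_complex_pure_triangles: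
  assumes "1 \<le> i"
  shows "pure_complex (jump_complex (3 * i) i)" "\<forall>F\<in>facets (jump_complex (3 * i) i). card F = 3"
proof -
  have "\<exists>H\<in>jump_complex (3 * i) i. F \<subseteq> H \<and> card H = 3" if F: "F \<in> jump_complex (3 * i) i" for F
  proof -
    have "\<exists>r<i. F \<subseteq> {r, r + i, r + 2 * i}"
    proof (cases "F = {}")
      case True
      then show ?thesis using assms by (intro exI[of _ 0]) simp
    next
      case False
      then obtain a where "a \<in> F" by blast
      then show ?thesis
        using jump_complex_face_in_triangle[OF F] assms by (intro exI[of _ "a mod i"]) simp
    qed
    then show ?thesis using jump_complex_triangle by meson
  qed
  note in_face_of_full_size = this
  show "pure_complex (jump_complex (3 * i) i)"
    by (rule pure_complexI(1)[OF abstract_complex_jump_complex in_face_of_full_size])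
  show "\<forall>F\<in>facets (jump_complex (3 * i) i). card F = 3"
    by (rule pure_complexI(2)[OF abstract_complex_jump_complex in_face_of_full_size])
qed

text \<open>
  The link of a vertex is the full simplex on the other two vertices of its triangle.
\<close>

lemma buchsbaum_triangles:
  fixes k :: "'k::field itself"
  assumes i: "1 \<le> i"
  shows "buchsbaum k (jump_complex (3 * i) i)"
  unfolding buchsbaum_def
proof (intro conjI allI impI)
  show "pure_complex (jump_complex (3 * i) i)" by (rule jump_complex_pure_triangles[OF i])
  fix x assume x: "{x} \<in> jump_complex (3 * i) i"
  let ?L = "link (jump_complex (3 * i) i) {x}"
  let ?T = "{x mod i, x mod i + i, x mod i + 2 * i}"
  have T: "?T \<in> jump_complex (3 * i) i" using i by (intro jump_complex_triangle) simp
  have "{x} \<subseteq> ?T" by (rule jump_complex_face_in_triangle[OF x]) simp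
  then have join: "{x} \<union> (?T - {x}) = ?T" by blast
  have "?T - {x} \<in> jump_complex (3 * i) i"
    by (rule face_subset[OF abstract_complex_jump_complex T]) blast
  then have mem: "?T - {x} \<in> ?L"
    unfolding link_def mem_Collect_eq join using T by (intro conjI) blast+
  have "H \<subseteq> ?T - {x}" if "H \<in> ?L" for H
  proof -
    have "{x} \<union> H \<in> jump_complex (3 * i) i" "{x} \<inter> H = {}" using that unfolding link_def by simp_all
    moreover from this(1) have "{x} \<union> H \<subseteq> ?T" by (rule jump_complex_face_in_triangle) simp
    ultimately show ?thesis by blast
  qed
  then have "\<Union>?L = ?T - {x}" using mem by blast
  then have "\<Union>?L \<in> ?L" using mem by simp
  then show "cohen_macaulay k ?L"
    by (intro cohen_macaulay_simplex abstract_complex_link[OF abstract_complex_jump_complex x])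
qed

section \<open>Properties of the circulant graph\<close>

theorem theorem4p2:
  fixes n i :: nat and S :: "nat set" and G :: "nat pair_pre_digraph"
    and k :: "'k::field itself"
  assumes "1 \<le> i" and "i \<le> n div 2"
    and "S = {1..n div 2} - {i}"
    and "G = circulant n S"
  shows "graph_has (buchsbaum k) G \<and>
    (graph_has vertex_decomposable G \<longleftrightarrow> gcd i n = 1) \<and>
    (graph_has shellable G \<longleftrightarrow> gcd i n = 1) \<and>
    (graph_has (cohen_macaulay k) G \<longleftrightarrow> gcd i n = 1)"
proof -
  let ?D = "jump_complex n i"
  have G: "ind_complex G = ?D"
    unfolding assms(3,4) by (rule ind_complex_circulant[OF assms(1,2)])
  have i: "1 \<le> i" "2 * i \<le> n" using assms(1,2) by simp_all
  have \<Delta>: "abstract_complex ?D" by (rule abstract_complex_jump_complex)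
  have edge: "{0, i} \<in> ?D" "card {0, i} = 2"
    using i by (simp_all add: jump_complex_def)
  have "pure_complex ?D \<and> buchsbaum k ?D \<and> (\<forall>F\<in>facets ?D. 2 \<le> card F) \<and>
    (gcd i n = 1 \<longrightarrow> vertex_decomposable ?D \<and> shellable ?D \<and> cohen_macaulay k ?D)"
  \<comment> \<open>The case \<open>n = 3 * i\<close> is the only one with faces of three vertices.\<close>
  proof (cases "n = 3 * i")
    case True
    have "?D = jump_complex (3 * i) i" using True by simp
    note triangles = jump_complex_pure_triangles[OF i(1), folded this]
      and bb = buchsbaum_triangles[OF i(1), of k, folded this]
    have "vertex_decomposable ?D \<and> shellable ?D \<and> cohen_macaulay k ?D" if "gcd i n = 1"
    proof -
      have "i = 1" using that True by simp
      then have "\<Union>?D = {0, i, 2 * i}" using True by (auto simp: vertices_jump_complex)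
      moreover have "{0, i, 2 * i} \<in> ?D"
        using jump_complex_triangle(1)[of 0 i] i True by simp
      ultimately have "\<Union>?D \<in> ?D" by (simp only:)
      then show ?thesis
        using vertex_decomposable_simplex[OF \<Delta>] shellable_simplex[OF \<Delta>] cohen_macaulay_simplex[OF \<Delta>]
        by blast
    qed
    then show ?thesis using triangles bb by simp
  next
    case False
    note pure = jump_complex_pure_dim_one[OF i False] and dim = jump_complex_dim_le_one[OF i False]
    have "vertex_decomposable ?D \<and> shellable ?D \<and> cohen_macaulay k ?D" if "gcd i n = 1"
    proof (intro conjI)
      have conn: "connected_complex ?D" using that jump_complex_connected_iff[OF i] by simp
      show "vertex_decomposable ?D" by (rule vertex_decomposable_if_connected[OF \<Delta> conn dim])
      show "shellable ?D" using pure(2) by (intro shellable_if_connected[OF pure(1) _ conn]) simp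
      show "cohen_macaulay k ?D" by (rule cohen_macaulay_if_connected[OF pure(1) dim conn])
    qed
    then show ?thesis using pure buchsbaum_dim_le_one[OF pure(1) dim] by simp
  qed
  then have pure: "pure_complex ?D" and bb: "buchsbaum k ?D"
    and facets: "\<And>F. F \<in> facets ?D \<Longrightarrow> 2 \<le> card F"
    and pos: "gcd i n = 1 \<Longrightarrow> vertex_decomposable ?D \<and> shellable ?D \<and> cohen_macaulay k ?D"
    by simp_all
  have "gcd i n = 1" if "vertex_decomposable ?D \<or> shellable ?D \<or> cohen_macaulay k ?D"
  proof -
    have "connected_complex ?D"
      using that
    proof (elim disjE)
      assume "vertex_decomposable ?D"
      then show ?thesis using facets by (rule connected_if_vertex_decomposable)
    next
      assume "shellable ?D"
      then show ?thesis using facets by (rule connected_if_shellable)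
    next
      assume "cohen_macaulay k ?D"
      then show ?thesis by (rule connected_if_cohen_macaulay[OF _ edge(1)]) (simp only: edge(2))
    qed
    then show ?thesis using jump_complex_connected_iff[OF i] by simp
  qed
  then have "vertex_decomposable ?D \<longleftrightarrow> gcd i n = 1" "shellable ?D \<longleftrightarrow> gcd i n = 1"
    "cohen_macaulay k ?D \<longleftrightarrow> gcd i n = 1"
    using pos by metis+
  then show ?thesis
    unfolding graph_has_def G using pure bb by simp
qed

end
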